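(* Let $A_i=\begin{pmatrix}a_i&b_i\\c_i&d_i\end{pmatrix}\in\mathbb{R}^{2\times2}$ with $\det A_i=1$ and $b_i>0$ for $i=1,2$, and let $\mathcal{L}$ be the associated two-sided quaternionic linear canonical transform. For every $f\in L^2(\mathbb{R}^2;\mathbb{H})$, $$\|f\|^2=\|\mathcal{L}(f)\|^2 .$$
   Context: $\mathbb{H}$ denotes the real quaternions with units $\mathbf{i},\mathbf{j},\mathbf{k}$, and $\|f\|^2=\int_{\mathbb{R}^2}|f(x,y)|^2\,dx\,dy$. The two-sided quaternionic linear canonical transform is $$\mathcal{L}(f)(u,v)=\int_{\mathbb{R}^2}K^{\mathbf{i}}_{A_1}(x,u)\,f(x,y)\,K^{\mathbf{j}}_{A_2}(y,v)\,dx\,dy$$ for $f\in L^1\cap L^2(\mathbb{R}^2;\mathbb{H})$, extended by continuity to $L^2(\mathbb{R}^2;\mathbb{H})$, where $$K^{\mathbf{i}}_{A_1}(x,u)=\frac{1}{\sqrt{\mathbf{i}2\pi b_1}}e^{\mathbf{i}\left(\frac{a_1}{2b_1}x^2-\frac{1}{b_1}xu+\frac{d_1}{2b_1}u^2\right)},\qquad K^{\mathbf{j}}_{A_2}(y,v)=\frac{1}{\sqrt{\mathbf{j}2\pi b_2}}e^{\mathbf{j}\left(\frac{a_2}{2b_2}y^2-\frac{1}{b_2}yv+\frac{d_2}{2b_2}v^2\right)} .$$ Square roots are principal: $\sqrt{\mathbf{i}}=e^{\mathbf{i}\pi/4}$, $\sqrt{\mathbf{j}}=e^{\mathbf{j}\pi/4}$.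 *)

theory Defs
  imports "HOL-Analysis.Analysis"
begin

datatype quat = Quat (qRe: real) (qIm1: real) (qIm2: real) (qIm3: real)

lemma quat_eq_iff:
  "x = y \<longleftrightarrow> qRe x = qRe y \<and> qIm1 x = qIm1 y \<and> qIm2 x = qIm2 y \<and> qIm3 x = qIm3 y"
  by (cases x; cases y) auto

instantiation quat :: ring_1
begin

definition "0 = Quat 0 0 0 0"
definition "1 = Quat 1 0 0 0"
definition "x + y = Quat (qRe x + qRe y) (qIm1 x + qIm1 y) (qIm2 x + qIm2 y) (qIm3 x + qIm3 y)"
definition "- x = Quat (- qRe x) (- qIm1 x) (- qIm2 x) (- qIm3 x)"
definition "x - y = Quat (qRe x - qRe y) (qIm1 x - qIm1 y) (qIm2 x - qIm2 y) (qIm3 x - qIm3 y)"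
definition "x * y = Quat
  (qRe x * qRe y - qIm1 x * qIm1 y - qIm2 x * qIm2 y - qIm3 x * qIm3 y)
  (qRe x * qIm1 y + qIm1 x * qRe y + qIm2 x * qIm3 y - qIm3 x * qIm2 y)
  (qRe x * qIm2 y - qIm1 x * qIm3 y + qIm2 x * qRe y + qIm3 x * qIm1 y)
  (qRe x * qIm3 y + qIm1 x * qIm2 y - qIm2 x * qIm1 y + qIm3 x * qRe y)"

lemma quat_ring_sel [simp]:
  "qRe 0 = 0" "qIm1 0 = 0" "qIm2 0 = 0" "qIm3 0 = 0"
  "qRe 1 = 1" "qIm1 1 = 0" "qIm2 1 = 0" "qIm3 1 = 0"
  "qRe (x + y) = qRe x + qRe y" "qIm1 (x + y) = qIm1 x + qIm1 y"
  "qIm2 (x + y) = qIm2 x + qIm2 y" "qIm3 (x + y) = qIm3 x + qIm3 y"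
  "qRe (- x) = - qRe x" "qIm1 (- x) = - qIm1 x"
  "qIm2 (- x) = - qIm2 x" "qIm3 (- x) = - qIm3 x"
  "qRe (x - y) = qRe x - qRe y" "qIm1 (x - y) = qIm1 x - qIm1 y"
  "qIm2 (x - y) = qIm2 x - qIm2 y" "qIm3 (x - y) = qIm3 x - qIm3 y"
  by (simp_all add: zero_quat_def one_quat_def plus_quat_def uminus_quat_def minus_quat_def)

lemma quat_times_sel [simp]:
  "qRe (x * y) = qRe x * qRe y - qIm1 x * qIm1 y - qIm2 x * qIm2 y - qIm3 x * qIm3 y"
  "qIm1 (x * y) = qRe x * qIm1 y + qIm1 x * qRe y + qIm2 x * qIm3 y - qIm3 x * qIm2 y"
  "qIm2 (x * y) = qRe x * qIm2 y - qIm1 x * qIm3 y + qIm2 x * qRe y + qIm3 x * qIm1 y"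
  "qIm3 (x * y) = qRe x * qIm3 y + qIm1 x * qIm2 y - qIm2 x * qIm1 y + qIm3 x * qRe y"
  by (simp_all add: times_quat_def)

instance
  by standard (auto simp: quat_eq_iff algebra_simps)

end

instantiation quat :: real_algebra_1
begin

definition "r *\<^sub>R x = Quat (r * qRe x) (r * qIm1 x) (r * qIm2 x) (r * qIm3 x)"

lemma quat_scaleR_sel [simp]:
  "qRe (r *\<^sub>R x) = r * qRe x" "qIm1 (r *\<^sub>R x) = r * qIm1 x"
  "qIm2 (r *\<^sub>R x) = r * qIm2 x" "qIm3 (r *\<^sub>R x) = r * qIm3 x"
  by (simp_all add: scaleR_quat_def)

instance
  by standard (auto simp: quat_eq_iff algebra_simps)

end

instantiation quat :: real_inner
begin

definition "inner x y = qRe x * qRe y + qIm1 x * qIm1 y + qIm2 x * qIm2 y + qIm3 x * qIm3 y"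
  for x y :: quat
definition "norm x = sqrt ((qRe x)\<^sup>2 + (qIm1 x)\<^sup>2 + (qIm2 x)\<^sup>2 + (qIm3 x)\<^sup>2)"
definition "sgn x = x /\<^sub>R norm x" for x :: quat
definition "dist x y = norm (x - y)" for x y :: quat
definition [code del]:
  "(uniformity :: (quat \<times> quat) filter) = (INF e\<in>{0 <..}. principal {(x, y). dist x y < e})"
definition [code del]:
  "open (U :: quat set) \<longleftrightarrow> (\<forall>x\<in>U. eventually (\<lambda>(x', y). x' = x \<longrightarrow> y \<in> U) uniformity)"

instance
proof
  fix x y z :: quat and r :: real and U :: "quat set"
  show "dist x y = norm (x - y)" by (rule dist_quat_def)
  show "sgn x = x /\<^sub>R norm x" by (rule sgn_quat_def)
  show "uniformity = (INF e\<in>{0 <..}. principal {(x :: quat, y). dist x y < e})"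
    by (rule uniformity_quat_def)
  show "open U \<longleftrightarrow> (\<forall>x\<in>U. eventually (\<lambda>(x', y). x' = x \<longrightarrow> y \<in> U) uniformity)"
    by (rule open_quat_def)
  show "inner x y = inner y x"
    by (simp add: inner_quat_def mult.commute)
  show "inner (x + y) z = inner x z + inner y z"
    by (simp add: inner_quat_def algebra_simps)
  show "inner (r *\<^sub>R x) y = r * inner x y"
    by (simp add: inner_quat_def algebra_simps)
  show "0 \<le> inner x x"
    by (simp add: inner_quat_def)
  show "inner x x = 0 \<longleftrightarrow> x = 0"
    by (auto simp: inner_quat_def quat_eq_iff add_nonneg_eq_0_iff)
  show "norm x = sqrt (inner x x)"
    by (simp add: inner_quat_def norm_quat_def power2_eq_square)
qed

end

instantiation quat :: real_normed_div_algebra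
begin

definition "inverse x = Quat (qRe x) (- qIm1 x) (- qIm2 x) (- qIm3 x) /\<^sub>R (norm x)\<^sup>2"
  for x :: quat
definition "x div y = x * inverse y" for x y :: quat

lemma quat_norm_sq: "(norm x)\<^sup>2 = (qRe x)\<^sup>2 + (qIm1 x)\<^sup>2 + (qIm2 x)\<^sup>2 + (qIm3 x)\<^sup>2"
  for x :: quat
  by (simp add: norm_quat_def)

instance
proof
  fix x y :: quat
  show "x div y = x * inverse y" by (rule divide_quat_def)
  show "inverse (0::quat) = 0"
    by (simp add: inverse_quat_def quat_eq_iff)
  show "norm (x * y) = norm x * norm y"
    unfolding norm_quat_def real_sqrt_mult[symmetric]
    by (rule arg_cong[where f = sqrt]) (simp add: power2_eq_square algebra_simps)
  show "inverse x * x = 1" if "x \<noteq> 0"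
  proof -
    have "(norm x)\<^sup>2 \<noteq> 0" using that by simp
    moreover have "Quat (qRe x) (- qIm1 x) (- qIm2 x) (- qIm3 x) * x = (norm x)\<^sup>2 *\<^sub>R 1"
      unfolding quat_norm_sq by (simp add: quat_eq_iff power2_eq_square)
    ultimately show ?thesis
      by (simp add: inverse_quat_def)
  qed
  show "x * inverse x = 1" if "x \<noteq> 0"
  proof -
    have "(norm x)\<^sup>2 \<noteq> 0" using that by simp
    moreover have "x * Quat (qRe x) (- qIm1 x) (- qIm2 x) (- qIm3 x) = (norm x)\<^sup>2 *\<^sub>R 1"
      unfolding quat_norm_sq by (simp add: quat_eq_iff power2_eq_square)
    ultimately show ?thesis
      by (simp add: inverse_quat_def)
  qed
qed

end

definition quat_i :: quat ("\<i>\<^sub>q") where "\<i>\<^sub>q = Quat 0 1 0 0"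
definition quat_j :: quat ("\<j>\<^sub>q") where "\<j>\<^sub>q = Quat 0 0 1 0"
definition quat_k :: quat ("\<k>\<^sub>q") where "\<k>\<^sub>q = Quat 0 0 0 1"

lemma quat_unit_sel [simp]:
  "qRe \<i>\<^sub>q = 0" "qIm1 \<i>\<^sub>q = 1" "qIm2 \<i>\<^sub>q = 0" "qIm3 \<i>\<^sub>q = 0"
  "qRe \<j>\<^sub>q = 0" "qIm1 \<j>\<^sub>q = 0" "qIm2 \<j>\<^sub>q = 1" "qIm3 \<j>\<^sub>q = 0"
  "qRe \<k>\<^sub>q = 0" "qIm1 \<k>\<^sub>q = 0" "qIm2 \<k>\<^sub>q = 0" "qIm3 \<k>\<^sub>q = 1"
  by (simp_all add: quat_i_def quat_j_def quat_k_def)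

lemma quat_units_mult:
  "\<i>\<^sub>q * \<i>\<^sub>q = -1" "\<j>\<^sub>q * \<j>\<^sub>q = -1" "\<k>\<^sub>q * \<k>\<^sub>q = -1"
  "\<i>\<^sub>q * \<j>\<^sub>q = \<k>\<^sub>q" "\<j>\<^sub>q * \<k>\<^sub>q = \<i>\<^sub>q" "\<k>\<^sub>q * \<i>\<^sub>q = \<j>\<^sub>q"
  "\<j>\<^sub>q * \<i>\<^sub>q = - \<k>\<^sub>q" "\<k>\<^sub>q * \<j>\<^sub>q = - \<i>\<^sub>q" "\<i>\<^sub>q * \<k>\<^sub>q = - \<j>\<^sub>q"
  by (simp_all add: quat_eq_iff)

instantiation quat :: euclidean_space
begin

definition "Basis = {1, \<i>\<^sub>q, \<j>\<^sub>q, \<k>\<^sub>q}"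

instance
proof
  fix u v x :: quat
  show "(Basis :: quat set) \<noteq> {}" "finite (Basis :: quat set)"
    by (simp_all add: Basis_quat_def)
  show "inner u v = (if u = v then 1 else 0)" if "u \<in> Basis" "v \<in> Basis"
    using that by (auto simp: Basis_quat_def inner_quat_def quat_eq_iff)
  show "(\<forall>u\<in>Basis. inner x u = 0) \<longleftrightarrow> x = 0"
    by (simp add: Basis_quat_def inner_quat_def) (auto simp: quat_eq_iff)
qed

end

text \<open>The embedding of the complex numbers onto the slice spanned by 1 and \<open>\<mu>\<close>;
  a ring homomorphism when \<open>\<mu> * \<mu> = -1\<close>.\<close>

definition quat_slice :: "quat \<Rightarrow> complex \<Rightarrow> quat"
  where "quat_slice \<mu> z = Re z *\<^sub>R 1 + Im z *\<^sub>R \<mu>"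

lemma quat_slice_exp:
  assumes "\<mu> * \<mu> = -1"
  shows "quat_slice \<mu> (exp z) = exp (quat_slice \<mu> z)"
proof -
  have bl: "bounded_linear (quat_slice \<mu>)"
    unfolding quat_slice_def
    by (intro bounded_linear_add bounded_linear_scaleR_const bounded_linear_Re bounded_linear_Im)
  have mult: "quat_slice \<mu> (a * b) = quat_slice \<mu> a * quat_slice \<mu> b" for a b
    using assms by (simp add: quat_slice_def algebra_simps)
  have pow: "quat_slice \<mu> (z ^ n) = quat_slice \<mu> z ^ n" for n
    by (induction n) (simp_all add: mult, simp add: quat_slice_def)
  have "quat_slice \<mu> (exp z) = (\<Sum>n. quat_slice \<mu> (z ^ n /\<^sub>R fact n))"
    unfolding exp_def by (rule bounded_linear.suminf[OF bl summable_exp_generic])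
  also have "\<dots> = exp (quat_slice \<mu> z)"
    unfolding exp_def by (simp add: pow linear_cmul[OF bounded_linear.linear[OF bl]])
  finally show ?thesis .
qed

text \<open>\<open>quat_csqrt \<mu> z\<close> is the principal square root of the element of the slice of \<open>\<mu>\<close>
  that corresponds to the complex number \<open>z\<close>.\<close>

definition quat_csqrt :: "quat \<Rightarrow> complex \<Rightarrow> quat"
  where "quat_csqrt \<mu> z = quat_slice \<mu> (csqrt z)"

lemma quat_csqrt_unit:
  assumes "\<mu> * \<mu> = -1" and "0 \<le> t"
  shows "quat_csqrt \<mu> (\<i> * of_real t) = sqrt t *\<^sub>R exp ((pi / 4) *\<^sub>R \<mu>)"
proof -
  define w where "w = of_real (sqrt t) * exp (\<i> * of_real (pi / 4))"
  have "w\<^sup>2 = of_real (sqrt t ^ 2) * exp (2 * (\<i> * of_real (pi / 4)))"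
    unfolding w_def power_mult_distrib exp_double of_real_power ..
  also have "2 * (\<i> * of_real (pi / 4)) = \<i> * of_real (pi / 2)"
    by simp
  also have "of_real (sqrt t ^ 2) * exp (\<i> * of_real (pi / 2)) = \<i> * of_real t"
    unfolding cis_conv_exp[symmetric] cis_pi_half using assms(2) by (simp add: mult.commute)
  finally have "w\<^sup>2 = \<i> * of_real t" .
  moreover have "0 < Re w \<or> Re w = 0 \<and> 0 \<le> Im w"
    using assms(2) by (cases "t = 0") (auto simp: w_def Re_exp cos_45 simp del: of_real_divide)
  ultimately have "csqrt (\<i> * of_real t) = w"
    by (metis csqrt_unique)
  moreover have "quat_slice \<mu> w = sqrt t *\<^sub>R quat_slice \<mu> (exp (\<i> * of_real (pi / 4)))"
    by (simp add: w_def quat_slice_def scaleR_right_distrib del: of_real_divide)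
  moreover have "quat_slice \<mu> (\<i> * of_real (pi / 4)) = (pi / 4) *\<^sub>R \<mu>"
    by (simp add: quat_slice_def del: of_real_divide)
  ultimately show ?thesis
    by (simp only: quat_csqrt_def quat_slice_exp[OF assms(1)])
qed

text \<open>The kernel \<open>K\<^sup>\<mu>\<^sub>A(x,u)\<close>, with \<open>a = A $ 1 $ 1\<close>, \<open>b = A $ 1 $ 2\<close>, \<open>d = A $ 2 $ 2\<close>.\<close>

definition lct_kernel :: "quat \<Rightarrow> real^2^2 \<Rightarrow> real \<Rightarrow> real \<Rightarrow> quat"
  where "lct_kernel \<mu> A x u =
    1 / quat_csqrt \<mu> (\<i> * of_real (2 * pi * A $ 1 $ 2)) *
    exp ((A $ 1 $ 1 / (2 * A $ 1 $ 2) * x\<^sup>2 - 1 / A $ 1 $ 2 * (x * u)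
           + A $ 2 $ 2 / (2 * A $ 1 $ 2) * u\<^sup>2) *\<^sub>R \<mu>)"

definition qlct_integral ::
    "real^2^2 \<Rightarrow> real^2^2 \<Rightarrow> (real \<times> real \<Rightarrow> quat) \<Rightarrow> real \<times> real \<Rightarrow> quat"
  where "qlct_integral A\<^sub>1 A\<^sub>2 f = (\<lambda>(u, v).
    \<integral>(x, y). lct_kernel \<i>\<^sub>q A\<^sub>1 x u * f (x, y) * lct_kernel \<j>\<^sub>q A\<^sub>2 y v \<partial>lebesgue)"

text \<open>The squared norm is extended-real valued, so that it is \<open>\<infinity>\<close>, and not 0 as for the
  Bochner integral, when the function is not square integrable.\<close>

definition L2_norm_sq :: "(real \<times> real \<Rightarrow> quat) \<Rightarrow> ennreal"
  where "L2_norm_sq f = (\<integral>\<^sup>+p. ennreal ((norm (f p))\<^sup>2) \<partial>lebesgue)"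

definition quat_L1 :: "(real \<times> real \<Rightarrow> quat) set"
  where "quat_L1 = {f. integrable lebesgue f}"

definition quat_L2 :: "(real \<times> real \<Rightarrow> quat) set"
  where "quat_L2 = {f \<in> borel_measurable lebesgue. L2_norm_sq f < \<infinity>}"

text \<open>\<open>g\<close> is a value at \<open>f\<close> of the extension by continuity, from \<open>L\<^sup>1 \<inter> L\<^sup>2\<close> to \<open>L\<^sup>2\<close>: the
  transforms of every approximating sequence converge to \<open>g\<close> in \<open>L\<^sup>2\<close>.  Since \<open>L\<^sup>1 \<inter> L\<^sup>2\<close>
  is dense in \<open>L\<^sup>2\<close>, this determines \<open>g\<close> up to a null set.\<close>

definition has_qlct ::
    "real^2^2 \<Rightarrow> real^2^2 \<Rightarrow> (real \<times> real \<Rightarrow> quat) \<Rightarrow> (real \<times> real \<Rightarrow> quat) \<Rightarrow> bool"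
  where "has_qlct A\<^sub>1 A\<^sub>2 f g \<longleftrightarrow> g \<in> quat_L2 \<and>
    (\<forall>h. (\<forall>n. h n \<in> quat_L1 \<inter> quat_L2) \<longrightarrow>
         (\<lambda>n. L2_norm_sq (\<lambda>p. h n p - f p)) \<longlonglongrightarrow> 0 \<longrightarrow>
         (\<lambda>n. L2_norm_sq (\<lambda>w. qlct_integral A\<^sub>1 A\<^sub>2 (h n) w - g w)) \<longlonglongrightarrow> 0)"

text \<open>A representative of the class \<open>\<L>(f)\<close>; unspecified if there were no \<open>g\<close> as above.\<close>

definition qlct ::
    "real^2^2 \<Rightarrow> real^2^2 \<Rightarrow> (real \<times> real \<Rightarrow> quat) \<Rightarrow> real \<times> real \<Rightarrow> quat"
  where "qlct A\<^sub>1 A\<^sub>2 f = (SOME g. has_qlct A\<^sub>1 A\<^sub>2 f g)"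

end

theory Submission
  imports Defs "HOL-Probability.Characteristic_Functions"
begin

text \<open>
  On a fixed slice of the quaternions the kernel of the linear canonical transform splits, up to a
  real constant, into a chirp in the time variable, a Fourier character, and a chirp in the
  frequency variable.  Left and right multiplication by unit quaternions preserves the norm, so the
  pointwise modulus of \<open>\<L>(f)\<close> is that of a rescaled two-sided quaternionic Fourier
  transform (QFT) of a function with the same modulus as \<open>f\<close> (\<open>qlct_integral_eq_qft\<close>).  The
  amplitudes \<open>1 / sqrt (2 * pi * b)\<close> of the kernels compensate exactly the Jacobian of the
  rescaling and the constant \<open>4 * pi\<^sup>2\<close> of the QFT, and everything reduces to the Plancherel
  identity for the QFT.

  For a bounded integrable \<open>F\<close> this identity is obtained by Gaussian regularisation.  The squared
  modulus of the QFT at a frequency \<open>w\<close> is a double integral over \<open>p\<close> and \<open>p'\<close> of the real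
  inner product of two modulated values of \<open>F\<close>.  In that inner product the exponentials on the
  left and on the right combine to exponentials of \<open>p - p'\<close> (\<open>inner_qft_phase\<close>), although the
  value in the middle does not commute with them.  Averaging over \<open>w\<close> with a Gaussian weight
  kills the sine terms, which carry all the noncommutativity, and leaves a real Gaussian in
  \<open>p - p'\<close> times the inner product of \<open>F p\<close> and \<open>F p'\<close>
  (\<open>gauss2_qft_phase_integral\<close>).  The weighted energy is therefore a Gaussian average of the
  autocorrelation of \<open>F\<close> (\<open>gauss2_weighted_qft_energy\<close>).  As the weight flattens out, the left
  side increases to the energy of the QFT, while the right side concentrates at the origin, where
  the autocorrelation is continuous and equals the energy of \<open>F\<close> (\<open>qft_plancherel_bounded\<close>).

  Truncation and Fatou's lemma turn the identity into a contraction estimate on all of \<open>L\<^sup>1\<close>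
  (\<open>qlct_integral_L2_le\<close>).  The truncations of a square integrable \<open>f\<close> converge to it in
  \<open>L\<^sup>2\<close>; by the contraction estimate their transforms are Cauchy, so by the Riesz-Fischer argument
  they have a limit, and the same estimate shows that every other approximating sequence leads to
  this limit (\<open>has_qlct_exists\<close>).  The truncations are bounded, their transforms have the same
  norm as they have, and the norm is continuous, which gives the theorem.
\<close>

section \<open>Exponentials of imaginary units\<close>

definition quat_cis :: "quat \<Rightarrow> real \<Rightarrow> quat"
  where "quat_cis \<mu> t = cos t *\<^sub>R 1 + sin t *\<^sub>R \<mu>"

lemma exp_scaleR_imaginary_unit:
  assumes "\<mu> * \<mu> = -1"
  shows "exp (t *\<^sub>R \<mu>) = quat_cis \<mu> t"
proof -
  have "exp (t *\<^sub>R \<mu>) = exp (quat_slice \<mu> (\<i> * of_real t))"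
    by (simp add: quat_slice_def)
  also have "\<dots> = quat_slice \<mu> (exp (\<i> * of_real t))"
    by (rule quat_slice_exp[OF assms, symmetric])
  also have "\<dots> = quat_cis \<mu> t"
    unfolding cis_conv_exp[symmetric] by (simp add: quat_slice_def quat_cis_def)
  finally show ?thesis .
qed

lemma quat_cis_0 [simp]: "quat_cis \<mu> 0 = 1"
  by (simp add: quat_cis_def)

lemma quat_cis_add:
  assumes "\<mu> * \<mu> = -1"
  shows "quat_cis \<mu> (s + t) = quat_cis \<mu> s * quat_cis \<mu> t"
  using assms by (simp add: quat_cis_def cos_add sin_add algebra_simps)

lemma inverse_quat_cis:
  assumes "\<mu> * \<mu> = -1"
  shows "inverse (quat_cis \<mu> t) = quat_cis \<mu> (- t)"
  using quat_cis_add[OF assms, of t "- t"] by (metis inverse_unique add.right_inverse quat_cis_0)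

lemma norm_quat_cis [simp]:
  "norm (quat_cis \<i>\<^sub>q t) = 1" "norm (quat_cis \<j>\<^sub>q t) = 1"
  by (simp_all add: quat_cis_def norm_quat_def)

lemma measurable_quat_cis [measurable]: "quat_cis \<mu> \<in> borel_measurable borel"
  unfolding quat_cis_def by measurable

text \<open>Multiplication by a unit quaternion on one side is an isometry whose adjoint is multiplication by
  the conjugate on the same side.\<close>

lemma inner_quat_cis_left:
  "inner (quat_cis \<i>\<^sub>q s * a) (quat_cis \<i>\<^sub>q t * b) = inner (quat_cis \<i>\<^sub>q (s - t) * a) b"
  by (simp add: quat_cis_def inner_quat_def cos_diff sin_diff algebra_simps)

lemma inner_quat_cis_right:
  "inner (a * quat_cis \<j>\<^sub>q s) (b * quat_cis \<j>\<^sub>q t) = inner (a * quat_cis \<j>\<^sub>q (s - t)) b"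
  by (simp add: quat_cis_def inner_quat_def cos_diff sin_diff algebra_simps)

text \<open>The integrand of the two-sided QFT at time \<open>p\<close> and frequency \<open>w\<close>, for a value \<open>q\<close> of the
  transformed function.\<close>

definition qft_phase :: "real \<times> real \<Rightarrow> real \<times> real \<Rightarrow> quat \<Rightarrow> quat"
  where "qft_phase p w q =
    quat_cis \<i>\<^sub>q (- (fst p * fst w)) * q * quat_cis \<j>\<^sub>q (- (snd p * snd w))"

lemma norm_qft_phase [simp]: "norm (qft_phase p w q) = norm q"
  by (simp add: qft_phase_def norm_mult)

lemma measurable_qft_phase [measurable (raw)]:
  assumes [measurable]: "f \<in> M \<rightarrow>\<^sub>M borel" "g \<in> M \<rightarrow>\<^sub>M borel" "h \<in> borel_measurable M"
  shows "(\<lambda>x. qft_phase (f x) (g x) (h x)) \<in> borel_measurable M"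
  unfolding qft_phase_def borel_prod[symmetric] using assms[folded borel_prod]
  by measurable

text \<open>Both adjoints stay on their own side, so that only the difference of the two times matters and
  the value \<open>a\<close> never has to be commuted with an exponential.\<close>

lemma inner_qft_phase:
  "inner (qft_phase p w a) (qft_phase p' w b) = inner (qft_phase (p - p') w a) b"
proof -
  have "inner (qft_phase p w a) (qft_phase p' w b) =
      inner (quat_cis \<i>\<^sub>q (- (fst p * fst w)) * (a * quat_cis \<j>\<^sub>q (- (snd p * snd w))))
            (quat_cis \<i>\<^sub>q (- (fst p' * fst w)) * (b * quat_cis \<j>\<^sub>q (- (snd p' * snd w))))"
    by (simp add: qft_phase_def mult.assoc)
  also have "\<dots> = inner ((quat_cis \<i>\<^sub>q (- (fst p * fst w) - - (fst p' * fst w)) * a) * quat_cis \<j>\<^sub>q (- (snd p * snd w)))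
     (b * quat_cis \<j>\<^sub>q (- (snd p' * snd w)))"
    by (simp only: inner_quat_cis_left mult.assoc)
  also have "\<dots> = inner (qft_phase (p - p') w a) b"
    by (simp only: inner_quat_cis_right) (simp add: qft_phase_def algebra_simps)
  finally show ?thesis .
qed

section \<open>Gaussian averages of the two-sided Fourier kernel\<close>

text \<open>Real and imaginary part of the characteristic function of the standard normal distribution.\<close>

lemma integral_std_normal_trig:
  shows "(\<integral>x. std_normal_density x * cos (t * x) \<partial>lborel) = exp (- t\<^sup>2 / 2)"
    and "(\<integral>x. std_normal_density x * sin (t * x) \<partial>lborel) = 0"
proof -
  have int: "integrable std_normal_distribution (\<lambda>x. iexp (t * x))"
    by (rule finite_measure.integrable_const_bound[of _ _ 1])
       (auto intro!: prob_space.finite_measure prob_space_normal_density)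
  have c: "(CLINT x|std_normal_distribution. iexp (t * x)) = complex_of_real (exp (- t\<^sup>2 / 2))"
    using char_std_normal_distribution by (simp add: char_def fun_eq_iff)
  have "(\<integral>x. Re (iexp (t * x)) \<partial>std_normal_distribution) = exp (- t\<^sup>2 / 2)"
    using integral_Re[OF int] c by simp
  then show "(\<integral>x. std_normal_density x * cos (t * x) \<partial>lborel) = exp (- t\<^sup>2 / 2)"
    by (simp add: integral_density Re_exp)
  have "(\<integral>x. Im (iexp (t * x)) \<partial>std_normal_distribution) = 0"
    using integral_Im[OF int] c by simp
  then show "(\<integral>x. std_normal_density x * sin (t * x) \<partial>lborel) = 0"
    by (simp add: integral_density Im_exp)
qed

lemma integrable_std_normal_trig:
  "integrable lborel (\<lambda>x. std_normal_density x * cos (t * x))"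
  "integrable lborel (\<lambda>x. std_normal_density x * sin (t * x))"
  by (rule Bochner_Integration.integrable_bound[OF integrable_normal_density[of 1 0]];
      auto simp: abs_mult intro!: mult_left_le)+

lemma integrable_lborel_pair_mult:
  fixes f :: "'a::euclidean_space \<Rightarrow> real" and g :: "'b::euclidean_space \<Rightarrow> real"
  assumes [measurable]: "integrable lborel f" "integrable lborel g"
  shows "integrable (lborel \<Otimes>\<^sub>M lborel) (\<lambda>z. f (fst z) * g (snd z))"
  using assms
  by (intro lborel_pair.Fubini_integrable) (auto simp: abs_mult)

lemma integral_lborel_pair_mult:
  fixes f :: "'a::euclidean_space \<Rightarrow> real" and g :: "'b::euclidean_space \<Rightarrow> real"
  assumes [measurable]: "integrable lborel f" "integrable lborel g"
  shows "(\<integral>z. f (fst z) * g (snd z) \<partial>(lborel \<Otimes>\<^sub>M lborel)) = (\<integral>x. f x \<partial>lborel) * (\<integral>y. g y \<partial>lborel)"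
  using lborel_pair.integral_fst'[OF integrable_lborel_pair_mult[OF assms]] by simp

definition gauss2 :: "real \<times> real \<Rightarrow> real"
  where "gauss2 w = std_normal_density (fst w) * std_normal_density (snd w)"

text \<open>The density is a constant multiple of its own Fourier transform and decreases along rays; both
  properties are read off from this form.\<close>

lemma gauss2_eq: "gauss2 w = exp (- (norm w)\<^sup>2 / 2) / (2 * pi)"
  by (cases w) (simp add: gauss2_def std_normal_density_def norm_Pair field_simps flip: exp_add)

lemma gauss2_nonneg [simp]: "0 \<le> gauss2 w"
  by (simp add: gauss2_def)

lemma measurable_gauss2 [measurable]: "gauss2 \<in> borel_measurable borel"
  unfolding gauss2_def borel_prod[symmetric] by measurable

lemma integrable_gauss2: "integrable lborel gauss2"
  unfolding gauss2_def lborel_prod[symmetric]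
  by (intro integrable_lborel_pair_mult) auto

lemma integral_gauss2: "(\<integral>w. gauss2 w \<partial>lborel) = 1"
  unfolding gauss2_def lborel_prod[symmetric]
  by (subst integral_lborel_pair_mult) auto

text \<open>Expanding both exponentials gives four terms, and the three that contain a sine integrate to
  zero.  These are the terms in which \<open>a\<close> is multiplied by an imaginary unit; the surviving one is
  a real multiple of \<open>inner a b\<close>.\<close>

lemma gauss2_qft_phase_integral:
  "(\<integral>w. gauss2 w * inner (qft_phase s w a) b \<partial>lborel) = 2 * pi * gauss2 s * inner a b"
proof -
  let ?N = std_normal_density
  let ?c = "\<lambda>x. ?N x * cos (fst s * x)" and ?s = "\<lambda>x. ?N x * sin (fst s * x)"
  let ?c' = "\<lambda>x. ?N x * cos (snd s * x)" and ?s' = "\<lambda>x. ?N x * sin (snd s * x)"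
  note trig = integrable_std_normal_trig
  note pair =
    integral_lborel_pair_mult[OF trig(1)[of "fst s"] trig(1)[of "snd s"]]
    integral_lborel_pair_mult[OF trig(2)[of "fst s"] trig(1)[of "snd s"]]
    integral_lborel_pair_mult[OF trig(1)[of "fst s"] trig(2)[of "snd s"]]
    integral_lborel_pair_mult[OF trig(2)[of "fst s"] trig(2)[of "snd s"]]
    integral_std_normal_trig
  have "(\<integral>w. gauss2 w * inner (qft_phase s w a) b \<partial>lborel) =
    (\<integral>w. (?c (fst w) * ?c' (snd w)) * inner a b
         - (?s (fst w) * ?c' (snd w)) * inner (\<i>\<^sub>q * a) b
         - (?c (fst w) * ?s' (snd w)) * inner (a * \<j>\<^sub>q) b
         + (?s (fst w) * ?s' (snd w)) * inner (\<i>\<^sub>q * a * \<j>\<^sub>q) b \<partial>(lborel \<Otimes>\<^sub>M lborel))"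
    unfolding lborel_prod
    by (intro Bochner_Integration.integral_cong)
       (auto simp: gauss2_def qft_phase_def quat_cis_def inner_quat_def algebra_simps)
  also have "\<dots> = exp (- (fst s)\<^sup>2 / 2) * exp (- (snd s)\<^sup>2 / 2) * inner a b"
    by (subst Bochner_Integration.integral_add Bochner_Integration.integral_diff;
        (intro Bochner_Integration.integrable_diff Bochner_Integration.integrable_add
               integrable_mult_left integrable_lborel_pair_mult integrable_std_normal_trig)?)+
       (simp add: pair)
  also have "\<dots> = 2 * pi * gauss2 s * inner a b"
    by (cases s) (simp add: gauss2_eq norm_Pair diff_divide_distrib flip: exp_add)
  finally show ?thesis .
qed

section \<open>Continuity of translations in the mean\<close>

lemma integrable_translate:
  fixes f :: "'a::euclidean_space \<Rightarrow> 'b::{banach, second_countable_topology}"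
  assumes "integrable lborel f"
  shows "integrable lborel (\<lambda>p. f (p + t))"
proof -
  have "integrable (distr lborel borel ((+) t)) f"
    using assms by (simp add: lborel_distr_plus)
  then show ?thesis
    by (simp add: integrable_distr_eq borel_measurable_integrable[OF assms, simplified] add.commute
        measurable_lborel1)
qed

lemma integral_translate:
  fixes f :: "'a::euclidean_space \<Rightarrow> 'b::{banach, second_countable_topology}"
  assumes "f \<in> borel_measurable borel"
  shows "(\<integral>p. f (p + t) \<partial>lborel) = (\<integral>p. f p \<partial>lborel)"
proof -
  have "(\<integral>p. f p \<partial>lborel) = (\<integral>p. f p \<partial>distr lborel borel ((+) t))"
    by (simp add: lborel_distr_plus)
  then show ?thesis
    using assms by (simp add: integral_distr add.commute)
qed

text \<open>Translation is an isometry of \<open>L\<^sup>1\<close>, so convergence along the translations \<open>t n\<close> passes to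
  limits in \<open>L\<^sup>1\<close>.\<close>

lemma L1_translation_approx:
  fixes f :: "'a::euclidean_space \<Rightarrow> 'b::{banach, second_countable_topology}"
  assumes f: "integrable lborel f"
    and approx: "\<And>e. e > 0 \<Longrightarrow> \<exists>g. integrable lborel g \<and> (\<integral>p. norm (f p - g p) \<partial>lborel) \<le> e \<and>
      (\<lambda>n. \<integral>p. norm (g (p + t n) - g p) \<partial>lborel) \<longlonglongrightarrow> 0"
  shows "(\<lambda>n. \<integral>p. norm (f (p + t n) - f p) \<partial>lborel) \<longlonglongrightarrow> 0"
proof (rule LIMSEQ_I)
  fix r :: real assume "r > 0"
  then obtain g where g: "integrable lborel g" and fg: "(\<integral>p. norm (f p - g p) \<partial>lborel) \<le> r / 3"
    and lim: "(\<lambda>n. \<integral>p. norm (g (p + t n) - g p) \<partial>lborel) \<longlonglongrightarrow> 0"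
    using approx[of "r / 3"] by auto
  note [measurable] = borel_measurable_integrable[OF f, unfolded measurable_lborel1]
    borel_measurable_integrable[OF g, unfolded measurable_lborel1]
  obtain N where N: "\<And>n. n \<ge> N \<Longrightarrow> norm ((\<integral>p. norm (g (p + t n) - g p) \<partial>lborel) - 0) < r / 3"
    using LIMSEQ_D[OF lim, of "r / 3"] \<open>r > 0\<close> by auto
  have "norm ((\<integral>p. norm (f (p + t n) - f p) \<partial>lborel) - 0) < r" if "n \<ge> N" for n
  proof -
    note int = f g integrable_translate[OF f, of "t n"] integrable_translate[OF g, of "t n"]
    have "(\<integral>p. norm (f (p + t n) - f p) \<partial>lborel) \<le>
      (\<integral>p. norm (f (p + t n) - g (p + t n)) + norm (g (p + t n) - g p) + norm (f p - g p) \<partial>lborel)"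
    proof (rule integral_mono)
      show "norm (f (p + t n) - f p) \<le>
        norm (f (p + t n) - g (p + t n)) + norm (g (p + t n) - g p) + norm (f p - g p)" for p
        by norm
    qed (use int in auto)
    also have "\<dots> = (\<integral>p. norm (f (p + t n) - g (p + t n)) \<partial>lborel)
        + (\<integral>p. norm (g (p + t n) - g p) \<partial>lborel) + (\<integral>p. norm (f p - g p) \<partial>lborel)"
      using int by simp
    also have "(\<integral>p. norm (f (p + t n) - g (p + t n)) \<partial>lborel) = (\<integral>p. norm (f p - g p) \<partial>lborel)"
      by (rule integral_translate) measurable
    finally show ?thesis
      using fg N[OF that] by (simp add: abs_less_iff)
  qed
  then show "\<exists>N. \<forall>n\<ge>N. norm ((\<integral>p. norm (f (p + t n) - f p) \<partial>lborel) - 0) < r"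
    by blast
qed

text \<open>A point of an open set stays in the set under all sufficiently small translations.  Hence the overlap
  of the set with its translates tends in measure to the whole set, by dominated convergence.\<close>

lemma L1_translation_open:
  fixes U :: "'a::euclidean_space set" and c :: "'b::{banach, second_countable_topology}"
  assumes U: "open U" "emeasure lborel U < \<infinity>" and t: "t \<longlonglongrightarrow> 0"
  shows "(\<lambda>n. \<integral>p. norm (indicator U (p + t n) *\<^sub>R c - indicator U p *\<^sub>R c) \<partial>lborel) \<longlonglongrightarrow> 0"
proof -
  have [measurable]: "U \<in> sets borel"
    using U by auto
  let ?I = "indicator U :: 'a \<Rightarrow> real"
  have I: "integrable lborel ?I"
    using U by simp
  have I': "integrable lborel (\<lambda>p. ?I (p + t n))" for n
    by (rule integrable_translate[OF I])
  have II: "integrable lborel (\<lambda>p. ?I (p + t n) * ?I p)" for n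
    by (rule Bochner_Integration.integrable_bound[OF I]) (auto simp: indicator_def)
  have "(\<lambda>n. \<integral>p. ?I (p + t n) * ?I p \<partial>lborel) \<longlonglongrightarrow> (\<integral>p. ?I p \<partial>lborel)"
  proof (rule integral_dominated_convergence[where w = ?I])
    show "AE p in lborel. (\<lambda>n. ?I (p + t n) * ?I p) \<longlonglongrightarrow> ?I p"
    proof (rule AE_I2)
      fix p
      show "(\<lambda>n. ?I (p + t n) * ?I p) \<longlonglongrightarrow> ?I p"
      proof (cases "p \<in> U")
        case True
        have "(\<lambda>n. p + t n) \<longlonglongrightarrow> p + 0"
          by (intro tendsto_intros t)
        then have "\<forall>\<^sub>F n in sequentially. p + t n \<in> U"
          using topological_tendstoD[OF _ U(1)] True by fastforce
        then have "\<forall>\<^sub>F n in sequentially. ?I (p + t n) * ?I p = ?I p"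
          by eventually_elim (use True in simp)
        then show ?thesis
          by (rule tendsto_eventually)
      qed simp
    qed
    show "AE p in lborel. norm (?I (p + t n) * ?I p) \<le> ?I p" for n
      by (auto simp: indicator_def)
  qed (use I in auto)
  then have "(\<lambda>n. norm c * (2 * (\<integral>p. ?I p \<partial>lborel) - 2 * (\<integral>p. ?I (p + t n) * ?I p \<partial>lborel))) \<longlonglongrightarrow>
      norm c * (2 * (\<integral>p. ?I p \<partial>lborel) - 2 * (\<integral>p. ?I p \<partial>lborel))"
    by (intro tendsto_intros)
  moreover have "(\<integral>p. norm (indicator U (p + t n) *\<^sub>R c - indicator U p *\<^sub>R c) \<partial>lborel) =
      norm c * (2 * (\<integral>p. ?I p \<partial>lborel) - 2 * (\<integral>p. ?I (p + t n) * ?I p \<partial>lborel))" for n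
  proof -
    have "(\<integral>p. norm (indicator U (p + t n) *\<^sub>R c - indicator U p *\<^sub>R c) \<partial>lborel) =
      (\<integral>p. norm c * (?I (p + t n) + ?I p - 2 * (?I (p + t n) * ?I p)) \<partial>lborel)"
      by (intro Bochner_Integration.integral_cong) (auto simp: indicator_def)
    also have "\<dots> = norm c * ((\<integral>p. ?I (p + t n) \<partial>lborel) + (\<integral>p. ?I p \<partial>lborel)
        - 2 * (\<integral>p. ?I (p + t n) * ?I p \<partial>lborel))"
      using I I' II by simp
    also have "(\<integral>p. ?I (p + t n) \<partial>lborel) = (\<integral>p. ?I p \<partial>lborel)"
      by (rule integral_translate) measurable
    finally show ?thesis by simp
  qed
  ultimately show ?thesis by simp
qed

text \<open>Outer regularity approximates a set of finite measure by open sets, and simple functions are dense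
  in \<open>L\<^sup>1\<close>.\<close>

lemma L1_translation_continuous:
  fixes f :: "'a::euclidean_space \<Rightarrow> 'b::{banach, second_countable_topology}"
  assumes f: "integrable lborel f" and t: "t \<longlonglongrightarrow> 0"
  shows "(\<lambda>n. \<integral>p. norm (f (p + t n) - f p) \<partial>lborel) \<longlonglongrightarrow> 0"
  using f
proof (induction rule: integrable_induct)
  case (base A c)
  then have A[measurable]: "A \<in> sets borel" by simp
  show ?case
  proof (rule L1_translation_approx)
    show "integrable lborel (\<lambda>x. indicator A x *\<^sub>R c)"
      using base by (intro integrable_scaleR_left) auto
    fix e :: real assume "e > 0"
    \<comment> \<open>The summand 1 covers \<open>c = 0\<close>.\<close>
    define d where "d = e / (norm c + 1)"
    have "d > 0"
      using \<open>e > 0\<close> by (simp add: d_def add_nonneg_pos)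
    then obtain U where U: "open U" "A \<subseteq> U" "emeasure lborel (U - A) < ennreal d"
      using outer_regular_lborel[OF A] by (metis ennreal_less_zero_iff)
    have [measurable]: "U \<in> sets borel" using U by auto
    have "emeasure lborel U = emeasure lborel A + emeasure lborel (U - A)"
      using U(2) by (subst plus_emeasure) (auto intro!: arg_cong[where f = "emeasure lborel"])
    also have "\<dots> < \<infinity>"
      using base(2) U(3) by (simp add: ennreal_add_less_top[symmetric] less_trans[OF _ ennreal_less_top])
    finally have fin: "emeasure lborel U < \<infinity>" .
    have "(\<integral>p. norm (indicator A p *\<^sub>R c - indicator U p *\<^sub>R c) \<partial>lborel) =
        (\<integral>p. norm c * indicator (U - A) p \<partial>lborel)"
      using U(2) by (intro Bochner_Integration.integral_cong) (auto simp: indicator_def)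
    also have "\<dots> = norm c * measure lborel (U - A)"
      by simp
    also have "\<dots> \<le> norm c * d"
      using U(3) \<open>d > 0\<close> by (intro mult_left_mono) (auto simp: measure_def enn2real_leI)
    also have "\<dots> \<le> e"
    proof -
      have "e = (norm c + 1) * d"
        using norm_ge_zero[of c] by (simp add: d_def add_nonneg_eq_0_iff)
      then show ?thesis
        using \<open>d > 0\<close> by (simp add: algebra_simps)
    qed
    finally show "\<exists>g. integrable lborel g \<and>
        (\<integral>p. norm (indicator A p *\<^sub>R c - g p) \<partial>lborel) \<le> e \<and>
        (\<lambda>n. \<integral>p. norm (g (p + t n) - g p) \<partial>lborel) \<longlonglongrightarrow> 0"
      using fin L1_translation_open[OF U(1) fin t]
      by (intro exI[of _ "\<lambda>p. indicator U p *\<^sub>R c"]) (auto intro!: integrable_scaleR_left)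
  qed
next
  case (add f g)
  note int = add.hyps integrable_translate[OF add.hyps(1)] integrable_translate[OF add.hyps(2)]
  have "(\<lambda>n. (\<integral>p. norm (f (p + t n) - f p) \<partial>lborel) + (\<integral>p. norm (g (p + t n) - g p) \<partial>lborel)) \<longlonglongrightarrow> 0"
    using tendsto_add[OF add.IH] by simp
  moreover have "norm (\<integral>p. norm (f (p + t n) + g (p + t n) - (f p + g p)) \<partial>lborel) \<le>
      (\<integral>p. norm (f (p + t n) - f p) \<partial>lborel) + (\<integral>p. norm (g (p + t n) - g p) \<partial>lborel)" for n
  proof -
    have "(\<integral>p. norm (f (p + t n) + g (p + t n) - (f p + g p)) \<partial>lborel) \<le>
      (\<integral>p. norm (f (p + t n) - f p) + norm (g (p + t n) - g p) \<partial>lborel)"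
      by (rule integral_mono) (use int in \<open>auto intro: order_trans[OF norm_diff_triangle_ineq]\<close>)
    then show ?thesis
      using int by simp
  qed
  ultimately show ?case
    by (rule Lim_null_comparison[OF always_eventually[OF allI], rotated])
next
  case (lim f s)
  show ?case
  proof (rule L1_translation_approx[OF lim.hyps(4)])
    fix e :: real assume "e > 0"
    note [measurable] = borel_measurable_integrable[OF lim.hyps(4), unfolded measurable_lborel1]
      borel_measurable_integrable[OF lim.hyps(1), unfolded measurable_lborel1]
    have "(\<lambda>i. \<integral>p. norm (f p - s i p) \<partial>lborel) \<longlonglongrightarrow> (\<integral>p. 0 \<partial>(lborel :: 'a measure))"
    proof (rule integral_dominated_convergence[where w = "\<lambda>p. 3 * norm (f p)"])
      show "AE p in lborel. (\<lambda>i. norm (f p - s i p)) \<longlonglongrightarrow> 0"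
      proof (intro AE_I2 tendsto_norm_zero)
        show "(\<lambda>i. f p - s i p) \<longlonglongrightarrow> 0" for p
          using tendsto_diff[OF tendsto_const lim.hyps(2), of p "f p"] by simp
      qed
      show "AE p in lborel. norm (norm (f p - s i p)) \<le> 3 * norm (f p)" for i
      proof (rule AE_I2)
        show "norm (norm (f p - s i p)) \<le> 3 * norm (f p)" for p
          using lim.hyps(3)[of p i] norm_triangle_ineq4[of "f p" "s i p"] by simp
      qed
    qed (use lim.hyps(4) in auto)
    then obtain i where "(\<integral>p. norm (f p - s i p) \<partial>lborel) < e"
      using \<open>e > 0\<close> by (fastforce simp: eventually_sequentially dest: order_tendstoD(2))
    then show "\<exists>g. integrable lborel g \<and> (\<integral>p. norm (f p - g p) \<partial>lborel) \<le> e \<and>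
      (\<lambda>n. \<integral>p. norm (g (p + t n) - g p) \<partial>lborel) \<longlonglongrightarrow> 0"
      using lim.hyps(1) lim.IH by (intro exI[of _ "s i"]) auto
  qed
qed

section \<open>Plancherel for the two-sided quaternionic Fourier transform\<close>

lemma measurable_fst_borel [measurable (raw)]:
  fixes f :: "'a \<Rightarrow> 'b::second_countable_topology \<times> 'c::second_countable_topology"
  assumes "f \<in> M \<rightarrow>\<^sub>M borel"
  shows "(\<lambda>x. fst (f x)) \<in> M \<rightarrow>\<^sub>M borel"
  using assms unfolding borel_prod[symmetric] by measurable

lemma measurable_snd_borel [measurable (raw)]:
  fixes f :: "'a \<Rightarrow> 'b::second_countable_topology \<times> 'c::second_countable_topology"
  assumes "f \<in> M \<rightarrow>\<^sub>M borel"
  shows "(\<lambda>x. snd (f x)) \<in> M \<rightarrow>\<^sub>M borel"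
  using assms unfolding borel_prod[symmetric] by measurable

lemma integral_lborel2_affine:
  fixes f :: "real \<times> real \<Rightarrow> real"
  assumes [measurable]: "f \<in> borel_measurable borel" and "c > 0"
  shows "(\<integral>p. f p \<partial>lborel) = c\<^sup>2 * (\<integral>s. f (t + c *\<^sub>R s) \<partial>lborel)"
  using assms(2)
  by (subst lborel_affine[of c t]) (simp_all add: integral_density integral_distr power2_eq_square)

definition qft :: "(real \<times> real \<Rightarrow> quat) \<Rightarrow> real \<times> real \<Rightarrow> quat"
  where "qft F w = (\<integral>p. qft_phase p w (F p) \<partial>lborel)"

lemma integrable_qft_phase:
  assumes "integrable lborel F"
  shows "integrable lborel (\<lambda>p. qft_phase p w (F p))"
proof -
  have [measurable]: "F \<in> borel_measurable borel"
    using borel_measurable_integrable[OF assms] by simp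
  show ?thesis
    by (rule Bochner_Integration.integrable_bound[OF assms]) auto
qed

lemma measurable_qft:
  assumes [measurable]: "F \<in> borel_measurable borel"
  shows "qft F \<in> borel_measurable borel"
  unfolding qft_def by measurable

definition autocorrelation :: "(real \<times> real \<Rightarrow> quat) \<Rightarrow> real \<times> real \<Rightarrow> real"
  where "autocorrelation F t = (\<integral>p. inner (F (p + t)) (F p) \<partial>lborel)"

lemma measurable_autocorrelation:
  assumes [measurable]: "F \<in> borel_measurable borel"
  shows "autocorrelation F \<in> borel_measurable borel"
  unfolding autocorrelation_def by measurable

lemma autocorrelation_bound:
  assumes F: "integrable lborel F" and M: "\<And>p. norm (F p) \<le> M"
  shows "integrable lborel (\<lambda>p. inner (F (p + t)) (F p))"
    and "\<bar>autocorrelation F t\<bar> \<le> M * (\<integral>p. norm (F p) \<partial>lborel)"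
proof -
  have [measurable]: "F \<in> borel_measurable borel"
    using borel_measurable_integrable[OF F] by simp
  have le: "norm (inner (F (p + t)) (F p)) \<le> M * norm (F p)" for p
    using Cauchy_Schwarz_ineq2[of "F (p + t)" "F p"] mult_right_mono[OF M[of "p + t"], of "norm (F p)"]
    by simp
  have int: "integrable lborel (\<lambda>p. M * norm (F p))"
    using F by auto
  show int': "integrable lborel (\<lambda>p. inner (F (p + t)) (F p))"
    by (rule Bochner_Integration.integrable_bound[OF int])
       (use le in \<open>auto intro!: order_trans[OF _ abs_ge_self]\<close>)
  have "\<bar>autocorrelation F t\<bar> \<le> (\<integral>p. norm (inner (F (p + t)) (F p)) \<partial>lborel)"
    unfolding autocorrelation_def using integral_norm_bound[of lborel "\<lambda>p. inner (F (p + t)) (F p)"]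
    by simp
  also have "\<dots> \<le> (\<integral>p. M * norm (F p) \<partial>lborel)"
    by (rule integral_mono) (use int int' le in auto)
  finally show "\<bar>autocorrelation F t\<bar> \<le> M * (\<integral>p. norm (F p) \<partial>lborel)"
    by simp
qed

text \<open>Boundedness of \<open>F\<close> reduces this to the continuity of translations in \<open>L\<^sup>1\<close>.\<close>

lemma autocorrelation_tendsto:
  assumes F: "integrable lborel F" and M: "\<And>p. norm (F p) \<le> M" and t: "t \<longlonglongrightarrow> 0"
  shows "(\<lambda>n. autocorrelation F (t n)) \<longlonglongrightarrow> autocorrelation F 0"
proof -
  have [measurable]: "F \<in> borel_measurable borel"
    using borel_measurable_integrable[OF F] by simp
  have bound: "norm (autocorrelation F (t n) - autocorrelation F 0)
      \<le> M * (\<integral>p. norm (F (p + t n) - F p) \<partial>lborel)" for n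
  proof -
    have int: "integrable lborel (\<lambda>p. M * norm (F (p + t n) - F p))"
      using F integrable_translate[OF F, of "t n"] by auto
    have eq: "autocorrelation F (t n) - autocorrelation F 0 =
        (\<integral>p. inner (F (p + t n) - F p) (F p) \<partial>lborel)"
      using autocorrelation_bound(1)[OF F M, of "t n"] autocorrelation_bound(1)[OF F M, of 0]
      by (simp add: autocorrelation_def inner_diff_left)
    have "norm (\<integral>p. inner (F (p + t n) - F p) (F p) \<partial>lborel)
        \<le> (\<integral>p. M * norm (F (p + t n) - F p) \<partial>lborel)"
    proof (rule Bochner_Integration.integral_norm_bound_integral)
      show "integrable lborel (\<lambda>p. inner (F (p + t n) - F p) (F p))"
        using autocorrelation_bound(1)[OF F M, of "t n"] autocorrelation_bound(1)[OF F M, of 0]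
        by (simp add: inner_diff_left)
      show "norm (inner (F (p + t n) - F p) (F p)) \<le> M * norm (F (p + t n) - F p)" for p
        using Cauchy_Schwarz_ineq2[of "F (p + t n) - F p" "F p"]
          mult_left_mono[OF M[of p], of "norm (F (p + t n) - F p)"]
        by (simp add: mult.commute)
    qed (rule int)
    then show ?thesis
      by (simp add: eq)
  qed
  have "(\<lambda>n. M * (\<integral>p. norm (F (p + t n) - F p) \<partial>lborel)) \<longlonglongrightarrow> 0"
    by (intro tendsto_mult_right_zero L1_translation_continuous F t)
  then have "(\<lambda>n. autocorrelation F (t n) - autocorrelation F 0) \<longlonglongrightarrow> 0"
    by (rule Lim_null_comparison[OF always_eventually[OF allI[OF bound]]])
  then show ?thesis
    by (simp add: LIM_zero_iff)
qed

lemma inner_qft_phase_le: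
  "\<bar>inner (qft_phase p w a) (qft_phase p' w' b)\<bar> \<le> norm a * norm b"
  using Cauchy_Schwarz_ineq2[of "qft_phase p w a" "qft_phase p' w' b"] by simp

lemma qft_phase_rescale:
  assumes "e > 0"
  shows "qft_phase (s /\<^sub>R e) (e *\<^sub>R w) q = qft_phase s w q"
proof -
  have "inverse e * x * (e * y) = x * y" for x y :: real
    using assms by (simp add: field_simps)
  then show ?thesis
    unfolding qft_phase_def fst_scaleR snd_scaleR real_scaleR_def by (simp only:)
qed

lemma norm_qft_squared:
  assumes F: "integrable lborel F"
  shows "(norm (qft F w))\<^sup>2 =
    (\<integral>z. inner (qft_phase (fst z) w (F (fst z))) (qft_phase (snd z) w (F (snd z))) \<partial>lborel)"
proof -
  have [measurable]: "F \<in> borel_measurable borel"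
    using borel_measurable_integrable[OF F] by simp
  let ?A = "\<lambda>p. qft_phase p w (F p)"
  have A: "integrable lborel ?A"
    by (rule integrable_qft_phase[OF F])
  have "integrable (lborel \<Otimes>\<^sub>M lborel) (\<lambda>z. inner (?A (fst z)) (?A (snd z)))"
  proof (rule Bochner_Integration.integrable_bound)
    show "integrable (lborel \<Otimes>\<^sub>M lborel) (\<lambda>z. norm (F (fst z)) * norm (F (snd z)))"
      using F by (intro integrable_lborel_pair_mult) auto
    show "(\<lambda>z. inner (?A (fst z)) (?A (snd z))) \<in> borel_measurable (lborel \<Otimes>\<^sub>M lborel)"
      by measurable
  qed (auto intro!: AE_I2 inner_qft_phase_le)
  from lborel_pair.integral_fst'[OF this]
  have "(\<integral>z. inner (?A (fst z)) (?A (snd z)) \<partial>lborel) = (\<integral>p. \<integral>p'. inner (?A p) (?A p') \<partial>lborel \<partial>lborel)"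
    by (simp add: lborel_prod)
  also have "\<dots> = (\<integral>p. inner (?A p) (qft F w) \<partial>lborel)"
    unfolding qft_def using A by simp
  also have "\<dots> = inner (qft F w) (qft F w)"
    using A by (simp add: qft_def[of F])
  finally show ?thesis
    by (simp add: power2_norm_eq_inner)
qed

text \<open>The modulus squared of the QFT is a double integral over times; after the frequency has been
  integrated out first, the substitution \<open>p = p' + e *\<^sub>R s\<close> turns the Gaussian of width \<open>e\<close> in
  \<open>p - p'\<close> into the standard one.\<close>

lemma gauss2_weighted_qft_energy:
  assumes F: "integrable lborel F" and M: "\<And>p. norm (F p) \<le> M" and e: "e > 0"
  shows "integrable lborel (\<lambda>w. gauss2 (e *\<^sub>R w) * (norm (qft F w))\<^sup>2)" (is ?int)
    and "(\<integral>w. gauss2 (e *\<^sub>R w) * (norm (qft F w))\<^sup>2 \<partial>lborel) =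
      2 * pi * (\<integral>s. gauss2 s * autocorrelation F (e *\<^sub>R s) \<partial>lborel)" (is ?eq)
proof -
  have F_meas [measurable]: "F \<in> borel_measurable borel"
    using borel_measurable_integrable[OF F] by simp
  let ?\<Phi> = "\<lambda>w z. gauss2 (e *\<^sub>R w) *
     inner (qft_phase (fst z) w (F (fst z))) (qft_phase (snd z) w (F (snd z)))"
  have gauss: "integrable lborel (\<lambda>w. gauss2 (e *\<^sub>R w))"
  proof -
    have "integrable (density (distr lborel borel (\<lambda>x. 0 + e *\<^sub>R x)) (\<lambda>_. ennreal (\<bar>e\<bar> ^ DIM(real \<times> real)))) gauss2"
      using integrable_gauss2 e by (subst lborel_affine[of e 0, symmetric]) auto
    then show ?thesis
      using e by (simp add: integrable_density integrable_distr_eq)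
  qed
  have FF: "integrable lborel (\<lambda>z. norm (F (fst z)) * norm (F (snd z)))"
    using integrable_lborel_pair_mult[OF integrable_norm[OF F] integrable_norm[OF F]]
    by (simp only: lborel_prod)
  have int: "integrable (lborel \<Otimes>\<^sub>M lborel) (case_prod ?\<Phi>)"
  proof (rule Bochner_Integration.integrable_bound)
    show "integrable (lborel \<Otimes>\<^sub>M lborel)
        (\<lambda>y. gauss2 (e *\<^sub>R fst y) * (norm (F (fst (snd y))) * norm (F (snd (snd y)))))"
      using integrable_lborel_pair_mult[OF gauss FF] by simp
    show "case_prod ?\<Phi> \<in> borel_measurable (lborel \<Otimes>\<^sub>M lborel)"
      by measurable
    show "AE y in lborel \<Otimes>\<^sub>M lborel. norm (case_prod ?\<Phi> y) \<le>
       norm (gauss2 (e *\<^sub>R fst y) * (norm (F (fst (snd y))) * norm (F (snd (snd y)))))"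
      by (auto simp: abs_mult intro!: AE_I2 mult_left_mono inner_qft_phase_le)
  qed
  have energy: "(\<integral>z. ?\<Phi> w z \<partial>lborel) = gauss2 (e *\<^sub>R w) * (norm (qft F w))\<^sup>2" for w
    by (simp add: norm_qft_squared[OF F])
  show ?int
    using lborel_pair.integrable_fst[OF int] by (simp only: energy)

  have inner_w: "(\<integral>w. ?\<Phi> w z \<partial>lborel) =
      2 * pi / e\<^sup>2 * (gauss2 ((fst z - snd z) /\<^sub>R e) * inner (F (fst z)) (F (snd z)))" for z
  proof -
    let ?f = "\<lambda>w. gauss2 w * inner (qft_phase ((fst z - snd z) /\<^sub>R e) w (F (fst z))) (F (snd z))"
    have "(\<integral>w. ?\<Phi> w z \<partial>lborel) = (\<integral>w. ?f (0 + e *\<^sub>R w) \<partial>lborel)"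
      unfolding inner_qft_phase
      by (simp add: qft_phase_rescale[OF e])
    also have "\<dots> = (\<integral>w. ?f w \<partial>lborel) / e\<^sup>2"
      using e by (subst (2) integral_lborel2_affine[of _ e 0]) auto
    finally show ?thesis
      by (simp add: gauss2_qft_phase_integral)
  qed
  let ?\<Psi> = "\<lambda>p p'. 2 * pi / e\<^sup>2 * (gauss2 ((p - p') /\<^sub>R e) * inner (F p) (F p'))"
  have int2: "integrable (lborel \<Otimes>\<^sub>M lborel) (case_prod ?\<Psi>)"
    using lborel_pair.integrable_snd[OF int]
    unfolding inner_w lborel_prod case_prod_beta' .
  have int3: "integrable (lborel \<Otimes>\<^sub>M lborel) (\<lambda>(s, p). gauss2 s * inner (F (p + e *\<^sub>R s)) (F p))"
  proof (rule Bochner_Integration.integrable_bound)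
    show "integrable (lborel \<Otimes>\<^sub>M lborel) (\<lambda>y. gauss2 (fst y) * (M * norm (F (snd y))))"
      using F by (intro integrable_lborel_pair_mult integrable_gauss2) auto
    have "\<bar>inner (F (p + e *\<^sub>R s)) (F p)\<bar> \<le> \<bar>M\<bar> * norm (F p)" for p s
      using Cauchy_Schwarz_ineq2[of "F (p + e *\<^sub>R s)" "F p"]
        mult_right_mono[OF order_trans[OF M[of "p + e *\<^sub>R s"] abs_ge_self], of "norm (F p)"]
      by simp
    then show "AE y in lborel \<Otimes>\<^sub>M lborel. norm (case y of (s, p) \<Rightarrow> gauss2 s * inner (F (p + e *\<^sub>R s)) (F p))
        \<le> norm (gauss2 (fst y) * (M * norm (F (snd y))))"
      by (intro AE_I2) (auto simp: abs_mult split_beta intro!: mult_left_mono)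
  qed measurable
  have "(\<integral>w. gauss2 (e *\<^sub>R w) * (norm (qft F w))\<^sup>2 \<partial>lborel) = (\<integral>z. \<integral>w. ?\<Phi> w z \<partial>lborel \<partial>lborel)"
    unfolding energy[symmetric] by (rule lborel_pair.Fubini_integral[OF int, symmetric])
  also have "\<dots> = (\<integral>z. case_prod ?\<Psi> z \<partial>lborel)"
    by (simp only: inner_w case_prod_beta')
  also have "\<dots> = (\<integral>p'. \<integral>p. ?\<Psi> p p' \<partial>lborel \<partial>lborel)"
    using lborel_pair.integral_snd[OF int2] by (simp only: lborel_prod)
  also have "\<dots> = (\<integral>p'. 2 * pi * (\<integral>s. gauss2 s * inner (F (p' + e *\<^sub>R s)) (F p') \<partial>lborel) \<partial>lborel)"
  proof (rule Bochner_Integration.integral_cong[OF refl])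
    fix p' :: "real \<times> real"
    show "(\<integral>p. ?\<Psi> p p' \<partial>lborel) =
      2 * pi * (\<integral>s. gauss2 s * inner (F (p' + e *\<^sub>R s)) (F p') \<partial>lborel)"
      by (subst integral_lborel2_affine[of _ e p']) (use e in simp_all)
  qed
  also have "\<dots> = 2 * pi * (\<integral>s. gauss2 s * autocorrelation F (e *\<^sub>R s) \<partial>lborel)"
    using lborel_pair.Fubini_integral[OF int3] by (simp add: autocorrelation_def)
  finally show ?eq .
qed

text \<open>For \<open>e = 1 / (n + 1)\<close> the weights \<open>gauss2 (e *\<^sub>R w)\<close> increase to the constant \<open>1 / (2 * pi)\<close>, so monotone
  convergence applies to the frequency side; on the time side the autocorrelation is bounded and
  continuous at the origin, so dominated convergence applies.  Its value there is the energy of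
  \<open>F\<close>.\<close>

lemma qft_plancherel_bounded:
  assumes F: "integrable lborel F" and M: "\<And>p. norm (F p) \<le> M"
  shows "(\<integral>\<^sup>+w. ennreal ((norm (qft F w))\<^sup>2) \<partial>lborel) =
    ennreal (4 * pi\<^sup>2) * (\<integral>\<^sup>+p. ennreal ((norm (F p))\<^sup>2) \<partial>lborel)"
proof -
  have F_meas [measurable]: "F \<in> borel_measurable borel"
    using borel_measurable_integrable[OF F] by simp
  note [measurable] = measurable_qft[OF F_meas] measurable_autocorrelation[OF F_meas]
  let ?E = "\<lambda>n. 1 / real (Suc n)"
  let ?S = "\<lambda>n. \<integral>w. gauss2 (?E n *\<^sub>R w) * (norm (qft F w))\<^sup>2 \<partial>lborel"
  have E0: "?E \<longlonglongrightarrow> 0"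
    using LIMSEQ_inverse_real_of_nat by (simp add: inverse_eq_divide)
  have E_pos: "?E n > 0" for n
    by simp
  note S_eq = gauss2_weighted_qft_energy(2)[OF F M E_pos]
  have "(\<lambda>n. \<integral>s. gauss2 s * autocorrelation F (?E n *\<^sub>R s) \<partial>lborel) \<longlonglongrightarrow>
      (\<integral>s. gauss2 s * autocorrelation F 0 \<partial>lborel)"
  proof (rule integral_dominated_convergence[where w = "\<lambda>s. gauss2 s * (M * (\<integral>p. norm (F p) \<partial>lborel))"])
    show "AE s in lborel. (\<lambda>n. gauss2 s * autocorrelation F (?E n *\<^sub>R s)) \<longlonglongrightarrow> gauss2 s * autocorrelation F 0"
    proof (intro AE_I2 tendsto_mult tendsto_const autocorrelation_tendsto[OF F M])
      show "(\<lambda>n. ?E n *\<^sub>R s) \<longlonglongrightarrow> 0" for s :: "real \<times> real"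
        using tendsto_scaleR[OF E0 tendsto_const, of s] by simp
    qed
    show "AE s in lborel. norm (gauss2 s * autocorrelation F (?E n *\<^sub>R s))
        \<le> gauss2 s * (M * (\<integral>p. norm (F p) \<partial>lborel))" for n
      using autocorrelation_bound(2)[OF F M] by (auto simp: abs_mult intro!: mult_left_mono)
  qed (auto intro!: integrable_mult_left integrable_gauss2)
  then have "?S \<longlonglongrightarrow> 2 * pi * (\<integral>s. gauss2 s * autocorrelation F 0 \<partial>lborel)"
    unfolding S_eq by (rule tendsto_mult_left)
  then have lim_S: "?S \<longlonglongrightarrow> 2 * pi * autocorrelation F 0"
    by (simp add: integral_gauss2)
  have lim_S':  "(\<lambda>n. ennreal (?S n)) \<longlonglongrightarrow>
      (\<integral>\<^sup>+w. ennreal (1 / (2 * pi) * (norm (qft F w))\<^sup>2) \<partial>lborel)"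
  proof -
    have "(\<lambda>n. \<integral>\<^sup>+w. ennreal (gauss2 (?E n *\<^sub>R w) * (norm (qft F w))\<^sup>2) \<partial>lborel) \<longlonglongrightarrow>
      (\<integral>\<^sup>+w. ennreal (1 / (2 * pi) * (norm (qft F w))\<^sup>2) \<partial>lborel)"
    proof (rule nn_integral_LIMSEQ)
      show "incseq (\<lambda>n w. ennreal (gauss2 (?E n *\<^sub>R w) * (norm (qft F w))\<^sup>2))"
      proof (intro incseq_SucI le_funI ennreal_leI mult_right_mono)
        fix n and w :: "real \<times> real"
        have "(?E (Suc n) * norm w)\<^sup>2 \<le> (?E n * norm w)\<^sup>2"
          by (intro power_mono mult_right_mono) (auto simp: field_simps)
        then show "gauss2 (?E n *\<^sub>R w) \<le> gauss2 (?E (Suc n) *\<^sub>R w)"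
          by (simp add: gauss2_eq divide_right_mono)
      qed simp
      show "(\<lambda>n. ennreal (gauss2 (?E n *\<^sub>R w) * (norm (qft F w))\<^sup>2)) \<longlonglongrightarrow>
          ennreal (1 / (2 * pi) * (norm (qft F w))\<^sup>2)" for w
      proof (intro tendsto_ennrealI tendsto_mult tendsto_const)
        have "(\<lambda>n. exp (- (?E n * norm w)\<^sup>2 / 2) / (2 * pi)) \<longlonglongrightarrow> exp (- (0 * norm w)\<^sup>2 / 2) / (2 * pi)"
          by (intro tendsto_intros E0) auto
        then show "(\<lambda>n. gauss2 (?E n *\<^sub>R w)) \<longlonglongrightarrow> 1 / (2 * pi)"
          by (simp add: gauss2_eq)
      qed
    qed measurable
    moreover have "(\<integral>\<^sup>+w. ennreal (gauss2 (?E n *\<^sub>R w) * (norm (qft F w))\<^sup>2) \<partial>lborel) = ennreal (?S n)" for n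
      by (rule nn_integral_eq_integral[OF gauss2_weighted_qft_energy(1)[OF F M E_pos]]) simp
    ultimately show ?thesis
      by (simp only:)
  qed
  have "(\<integral>\<^sup>+w. ennreal (1 / (2 * pi) * (norm (qft F w))\<^sup>2) \<partial>lborel) =
      ennreal (2 * pi * autocorrelation F 0)"
    by (rule LIMSEQ_unique[OF lim_S' tendsto_ennrealI[OF lim_S]])
  also have "\<dots> = ennreal (2 * pi) * (\<integral>\<^sup>+p. ennreal ((norm (F p))\<^sup>2) \<partial>lborel)"
    using autocorrelation_bound(1)[OF F M, of 0]
    by (simp add: autocorrelation_def power2_norm_eq_inner nn_integral_eq_integral ennreal_mult')
  also have "(\<integral>\<^sup>+w. ennreal (1 / (2 * pi) * (norm (qft F w))\<^sup>2) \<partial>lborel) =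
      ennreal (1 / (2 * pi)) * (\<integral>\<^sup>+w. ennreal ((norm (qft F w))\<^sup>2) \<partial>lborel)"
    by (subst nn_integral_cmult[symmetric])
       (auto intro!: nn_integral_cong simp: ennreal_mult'[symmetric])
  finally have eq: "ennreal (1 / (2 * pi)) * (\<integral>\<^sup>+w. ennreal ((norm (qft F w))\<^sup>2) \<partial>lborel) =
      ennreal (2 * pi) * (\<integral>\<^sup>+p. ennreal ((norm (F p))\<^sup>2) \<partial>lborel)" .
  have "(\<integral>\<^sup>+w. ennreal ((norm (qft F w))\<^sup>2) \<partial>lborel) =
      ennreal (2 * pi) * (ennreal (1 / (2 * pi)) * (\<integral>\<^sup>+w. ennreal ((norm (qft F w))\<^sup>2) \<partial>lborel))"
    unfolding mult.assoc[symmetric] by (subst ennreal_mult'[symmetric]) auto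
  also have "\<dots> = ennreal (4 * pi\<^sup>2) * (\<integral>\<^sup>+p. ennreal ((norm (F p))\<^sup>2) \<partial>lborel)"
    unfolding eq mult.assoc[symmetric] by (subst ennreal_mult'[symmetric]) (auto simp: power2_eq_square)
  finally show ?thesis .
qed

section \<open>Mean square convergence\<close>

text \<open>Fatou's lemma in the form in which a uniform bound passes to the pointwise limit.\<close>

lemma nn_integral_lim_le:
  fixes u :: "nat \<Rightarrow> 'a \<Rightarrow> ennreal"
  assumes [measurable]: "\<And>n. u n \<in> borel_measurable M"
    and lim: "AE x in M. (\<lambda>n. u n x) \<longlonglongrightarrow> v x"
    and bound: "\<forall>\<^sub>F n in sequentially. (\<integral>\<^sup>+x. u n x \<partial>M) \<le> C"
  shows "(\<integral>\<^sup>+x. v x \<partial>M) \<le> C"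
proof -
  have "(\<integral>\<^sup>+x. v x \<partial>M) = (\<integral>\<^sup>+x. liminf (\<lambda>n. u n x) \<partial>M)"
    by (rule nn_integral_cong_AE) (use lim in \<open>auto elim!: eventually_mono simp: lim_imp_Liminf\<close>)
  also have "\<dots> \<le> liminf (\<lambda>n. \<integral>\<^sup>+x. u n x \<partial>M)"
    by (rule nn_integral_liminf) measurable
  also have "\<dots> \<le> liminf (\<lambda>n. C)"
    by (rule Liminf_mono[OF bound])
  finally show ?thesis by (simp add: Liminf_const)
qed

text \<open>The factor \<open>1 + d\<close> can be taken close to 1 at the expense of the other summand.  This replaces
  the triangle inequality for the \<open>L\<^sup>2\<close> norm, which does not combine well with squared norms.\<close>

lemma power2_norm_add_le:
  fixes a b :: "'a::real_normed_vector"
  assumes "d > 0"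
  shows "(norm (a + b))\<^sup>2 \<le> (1 + d) * (norm a)\<^sup>2 + (1 + 1 / d) * (norm b)\<^sup>2"
proof -
  have "(norm (a + b))\<^sup>2 \<le> (norm a + norm b)\<^sup>2"
    by (intro power_mono norm_triangle_ineq) auto
  also have "\<dots> = (norm a)\<^sup>2 + (norm b)\<^sup>2 + 2 * (norm a * norm b)"
    by (simp add: power2_sum algebra_simps)
  also have "2 * (norm a * norm b) \<le> d * (norm a)\<^sup>2 + (norm b)\<^sup>2 / d"
  proof -
    have "0 \<le> (d * norm a - norm b)\<^sup>2 / d"
      using assms by simp
    also have "\<dots> = d * (norm a)\<^sup>2 + (norm b)\<^sup>2 / d - 2 * (norm a * norm b)"
      using assms by (simp add: power2_eq_square field_simps)
    finally show ?thesis by simp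
  qed
  finally show ?thesis by (simp add: algebra_simps)
qed

lemma L2_norm_sq_add_le:
  assumes [measurable]: "f \<in> borel_measurable lebesgue" "g \<in> borel_measurable lebesgue" and "d > 0"
  shows "L2_norm_sq (\<lambda>p. f p + g p) \<le>
    ennreal (1 + d) * L2_norm_sq f + ennreal (1 + 1 / d) * L2_norm_sq g"
proof -
  have "L2_norm_sq (\<lambda>p. f p + g p) \<le>
    (\<integral>\<^sup>+p. ennreal (1 + d) * ennreal ((norm (f p))\<^sup>2) + ennreal (1 + 1 / d) * ennreal ((norm (g p))\<^sup>2) \<partial>lebesgue)"
    unfolding L2_norm_sq_def
  proof (rule nn_integral_mono)
    fix p
    have "ennreal ((norm (f p + g p))\<^sup>2) \<le> ennreal ((1 + d) * (norm (f p))\<^sup>2 + (1 + 1 / d) * (norm (g p))\<^sup>2)"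
      by (intro ennreal_leI power2_norm_add_le \<open>d > 0\<close>)
    also have "\<dots> = ennreal (1 + d) * ennreal ((norm (f p))\<^sup>2) + ennreal (1 + 1 / d) * ennreal ((norm (g p))\<^sup>2)"
      using \<open>d > 0\<close> by (simp add: ennreal_mult)
    finally show "ennreal ((norm (f p + g p))\<^sup>2) \<le>
      ennreal (1 + d) * ennreal ((norm (f p))\<^sup>2) + ennreal (1 + 1 / d) * ennreal ((norm (g p))\<^sup>2)" .
  qed
  also have "\<dots> = ennreal (1 + d) * L2_norm_sq f + ennreal (1 + 1 / d) * L2_norm_sq g"
    unfolding L2_norm_sq_def by (simp add: nn_integral_add nn_integral_cmult)
  finally show ?thesis .
qed

lemma L2_norm_sq_minus_commute: "L2_norm_sq (\<lambda>p. f p - g p) = L2_norm_sq (\<lambda>p. g p - f p)"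
  by (simp add: L2_norm_sq_def norm_minus_commute)

lemma L2_norm_sq_diff_le:
  assumes [measurable]: "f \<in> borel_measurable lebesgue" "g \<in> borel_measurable lebesgue"
    "h \<in> borel_measurable lebesgue"
  shows "L2_norm_sq (\<lambda>p. f p - h p) \<le> 2 * L2_norm_sq (\<lambda>p. f p - g p) + 2 * L2_norm_sq (\<lambda>p. g p - h p)"
  using L2_norm_sq_add_le[of "\<lambda>p. f p - g p" "\<lambda>p. g p - h p" 1] by simp

lemma quat_L2_diff:
  assumes "f \<in> quat_L2" "g \<in> quat_L2"
  shows "(\<lambda>p. f p - g p) \<in> quat_L2"
proof -
  have [measurable]: "f \<in> borel_measurable lebesgue" "g \<in> borel_measurable lebesgue"
    and fin: "L2_norm_sq f < \<infinity>" "L2_norm_sq g < \<infinity>"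
    using assms by (auto simp: quat_L2_def)
  have "L2_norm_sq (\<lambda>p. f p - g p) \<le> 2 * L2_norm_sq f + 2 * L2_norm_sq g"
    using L2_norm_sq_diff_le[of f "\<lambda>_. 0" g] L2_norm_sq_minus_commute[of "\<lambda>_. 0" g] by simp
  also have "\<dots> < \<infinity>"
    using fin by (simp add: ennreal_mult_less_top)
  finally show ?thesis
    by (simp add: quat_L2_def)
qed

text \<open>The parameter \<open>d\<close> of the weighted inequality is coupled to the distance: it tends to 0 slowly
  enough that distance divided by \<open>d\<close> also does.\<close>

lemma L2_norm_sq_tendsto:
  assumes a: "\<And>n. a n \<in> quat_L2" and b: "b \<in> quat_L2"
    and lim: "(\<lambda>n. L2_norm_sq (\<lambda>p. a n p - b p)) \<longlonglongrightarrow> 0"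
  shows "(\<lambda>n. L2_norm_sq (a n)) \<longlonglongrightarrow> L2_norm_sq b"
proof -
  have [measurable]: "\<And>n. a n \<in> borel_measurable lebesgue" "b \<in> borel_measurable lebesgue"
    and fin: "\<And>n. L2_norm_sq (a n) < \<infinity>" "L2_norm_sq b < \<infinity>"
    using a b by (auto simp: quat_L2_def)
  define x where "x n = enn2real (L2_norm_sq (a n))" for n
  define y where "y = enn2real (L2_norm_sq b)"
  define z where "z n = enn2real (L2_norm_sq (\<lambda>p. a n p - b p))" for n
  have x: "L2_norm_sq (a n) = ennreal (x n)" for n
    using fin(1)[of n] by (simp add: x_def)
  have y: "L2_norm_sq b = ennreal y"
    using fin(2) by (simp add: y_def)
  have z: "L2_norm_sq (\<lambda>p. a n p - b p) = ennreal (z n)" for n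
    using quat_L2_diff[OF a[of n] b] by (simp add: z_def quat_L2_def)
  have nn: "0 \<le> x n" "0 \<le> y" "0 \<le> z n" for n
    by (simp_all add: x_def y_def z_def)
  have z0: "z \<longlonglongrightarrow> 0"
    using lim unfolding z ennreal_0[symmetric] by (subst (asm) tendsto_ennreal_iff) (auto simp: nn)
  \<comment> \<open>The second summand keeps \<open>d n\<close> positive when the distance vanishes.\<close>
  define d where "d n = sqrt (z n) + 1 / real (Suc n)" for n
  have d_pos: "d n > 0" for n
    using nn by (simp add: d_def add_nonneg_pos)
  have s0: "(\<lambda>n. sqrt (z n)) \<longlonglongrightarrow> 0"
    using tendsto_real_sqrt[OF z0] by simp
  have d0: "d \<longlonglongrightarrow> 0"
    unfolding d_def using tendsto_add[OF s0 LIMSEQ_inverse_real_of_nat] by (simp add: inverse_eq_divide)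
  have zd: "(1 + 1 / d n) * z n \<le> z n + sqrt (z n)" for n
  proof -
    have "z n = sqrt (z n) * sqrt (z n)"
      using nn by simp
    also have "\<dots> \<le> sqrt (z n) * d n"
      using nn by (intro mult_left_mono) (auto simp: d_def)
    finally show ?thesis
      using d_pos[of n] by (simp add: field_simps)
  qed
  have upper: "x n \<le> (1 + d n) * y + (z n + sqrt (z n))" for n
  proof -
    have "ennreal (x n) \<le> ennreal ((1 + d n) * y + (1 + 1 / d n) * z n)"
      using L2_norm_sq_add_le[of b "\<lambda>p. a n p - b p" "d n"] d_pos[of n] nn
      by (simp add: x y z ennreal_mult' less_imp_le)
    then have "x n \<le> (1 + d n) * y + (1 + 1 / d n) * z n"
      by (subst (asm) ennreal_le_iff) (use d_pos[of n] nn in auto)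
    then show ?thesis
      using zd[of n] by linarith
  qed
  have lower: "(y - (z n + sqrt (z n))) / (1 + d n) \<le> x n" for n
  proof -
    have "ennreal y \<le> ennreal ((1 + d n) * x n + (1 + 1 / d n) * z n)"
      using L2_norm_sq_add_le[of "a n" "\<lambda>p. b p - a n p" "d n"] d_pos[of n] nn
        L2_norm_sq_minus_commute[of b "a n"]
      by (simp add: x y z ennreal_mult' less_imp_le)
    then have "y \<le> (1 + d n) * x n + (1 + 1 / d n) * z n"
      by (subst (asm) ennreal_le_iff) (use d_pos[of n] nn in auto)
    then have "y - (z n + sqrt (z n)) \<le> x n * (1 + d n)"
      using zd[of n] by (simp add: mult.commute)
    then show ?thesis
      using d_pos[of n] by (simp add: pos_divide_le_eq)
  qed
  have "(\<lambda>n. (1 + d n) * y + (z n + sqrt (z n))) \<longlonglongrightarrow> (1 + 0) * y + (0 + 0)"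
    by (intro tendsto_intros d0 z0 s0)
  moreover have "(\<lambda>n. (y - (z n + sqrt (z n))) / (1 + d n)) \<longlonglongrightarrow> (y - (0 + 0)) / (1 + 0)"
    by (intro tendsto_intros d0 z0 s0) auto
  ultimately have "x \<longlonglongrightarrow> y"
    using upper lower by (intro tendsto_sandwich[of "\<lambda>n. (y - (z n + sqrt (z n))) / (1 + d n)" x sequentially
        "\<lambda>n. (1 + d n) * y + (z n + sqrt (z n))" y]) auto
  then show ?thesis
    unfolding x y by (rule tendsto_ennrealI)
qed

text \<open>The decay rate leaves room for the weights \<open>4 ^ n\<close>: the weighted sum of the squared increments
  has a finite integral, so it is finite almost everywhere, and there the increments are dominated
  by a multiple of \<open>(1/2) ^ n\<close>.\<close>

lemma fast_L2_Cauchy_AE_convergent: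
  fixes q :: "nat \<Rightarrow> 'a \<Rightarrow> 'b::{banach, second_countable_topology}"
  assumes [measurable]: "\<And>n. q n \<in> borel_measurable M"
    and fast: "\<And>n. (\<integral>\<^sup>+x. ennreal ((norm (q n x - q (Suc n) x))\<^sup>2) \<partial>M) \<le> ennreal (4 * (1/16) ^ n)"
  shows "AE x in M. convergent (\<lambda>n. q n x)"
proof -
  let ?D = "\<lambda>n x. 4 ^ n * (norm (q n x - q (Suc n) x))\<^sup>2"
  have "(\<integral>\<^sup>+x. (\<Sum>n. ennreal (?D n x)) \<partial>M) = (\<Sum>n. \<integral>\<^sup>+x. ennreal (?D n x) \<partial>M)"
    by (rule nn_integral_suminf) measurable
  also have "\<dots> \<le> (\<Sum>n. ennreal (4 * (1/4) ^ n))"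
  proof (intro suminf_le)
    fix n
    have "(\<integral>\<^sup>+x. ennreal (?D n x) \<partial>M) = ennreal (4 ^ n) * (\<integral>\<^sup>+x. ennreal ((norm (q n x - q (Suc n) x))\<^sup>2) \<partial>M)"
      by (subst nn_integral_cmult[symmetric]) (auto intro!: nn_integral_cong simp: ennreal_mult')
    also have "\<dots> \<le> ennreal (4 ^ n) * ennreal (4 * (1/16) ^ n)"
      by (intro mult_left_mono fast) auto
    also have "\<dots> = ennreal (4 * (4 * (1/16)) ^ n)"
      unfolding power_mult_distrib by (subst ennreal_mult'[symmetric]) (auto simp: mult_ac)
    finally show "(\<integral>\<^sup>+x. ennreal (?D n x) \<partial>M) \<le> ennreal (4 * (1/4) ^ n)"
      by simp
  qed auto
  also have "\<dots> < \<infinity>"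
    by (subst suminf_ennreal2) (auto intro!: summable_mult summable_geometric)
  finally have "AE x in M. (\<Sum>n. ennreal (?D n x)) \<noteq> \<infinity>"
    by (intro nn_integral_noteq_infinite) auto
  then show ?thesis
  proof eventually_elim
    case (elim x)
    then have "summable (\<lambda>n. ?D n x)"
      by (intro summable_suminf_not_top) auto
    then have "Bseq (\<lambda>n. ?D n x)"
      by (intro convergent_imp_Bseq) (auto dest: summable_LIMSEQ_zero simp: convergent_def)
    then obtain K where K: "K > 0" "\<And>n. ?D n x \<le> K"
      by (auto simp: Bseq_def)
    have "norm (q (Suc n) x - q n x) \<le> sqrt K * (1/2) ^ n" for n
    proof -
      have "(2 ^ n * norm (q n x - q (Suc n) x))\<^sup>2 \<le> K"
      proof -
        have "(2 ^ n)\<^sup>2 = (4 ^ n :: real)"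
          unfolding power2_eq_square power_mult_distrib[symmetric] by simp
        then show ?thesis
          using K(2)[of n] by (simp add: power_mult_distrib)
      qed
      then have "2 ^ n * norm (q n x - q (Suc n) x) \<le> sqrt K"
        by (rule real_le_rsqrt)
      then show ?thesis
        by (simp add: norm_minus_commute power_one_over field_simps)
    qed
    then have "summable (\<lambda>n. q (Suc n) x - q n x)"
      by (intro summable_comparison_test[OF _ summable_mult[OF summable_geometric[of "1/2::real"]]]) auto
    then have "convergent (\<lambda>n. \<Sum>k<n. q (Suc k) x - q k x)"
      by (simp add: summable_iff_convergent)
    moreover have "(\<Sum>k<n. q (Suc k) x - q k x) = q n x - q 0 x" for n
      by (rule sum_lessThan_telescope[of "\<lambda>k. q k x"])
    ultimately have "convergent (\<lambda>n. q n x - q 0 x)"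
      by simp
    then show "convergent (\<lambda>n. q n x)"
      using convergent_add[OF _ convergent_const[of "q 0 x"]] by fastforce
  qed
qed

text \<open>The Riesz-Fischer theorem for a rapidly converging sequence.  The bound
  \<open>4 * (1/16) ^ n\<close> arises for elements whose squared distances to a common limit are at most
  \<open>(1/16) ^ n\<close>.\<close>

lemma fast_L2_Cauchy_limit:
  fixes q :: "nat \<Rightarrow> 'a \<Rightarrow> 'b::{banach, second_countable_topology}"
  assumes [measurable]: "\<And>n. q n \<in> borel_measurable M"
    and fast: "\<And>n m. n \<le> m \<Longrightarrow> (\<integral>\<^sup>+x. ennreal ((norm (q n x - q m x))\<^sup>2) \<partial>M) \<le> ennreal (4 * (1/16) ^ n)"
  obtains g where "g \<in> borel_measurable M"
    and "\<And>n. (\<integral>\<^sup>+x. ennreal ((norm (q n x - g x))\<^sup>2) \<partial>M) \<le> ennreal (4 * (1/16) ^ n)"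
proof
  let ?g = "\<lambda>x. lim (\<lambda>n. q n x)"
  show [measurable]: "?g \<in> borel_measurable M"
    by measurable
  have conv: "AE x in M. (\<lambda>n. q n x) \<longlonglongrightarrow> ?g x"
    using fast_L2_Cauchy_AE_convergent[of q M] fast by (simp add: convergent_LIMSEQ_iff)
  show "(\<integral>\<^sup>+x. ennreal ((norm (q n x - ?g x))\<^sup>2) \<partial>M) \<le> ennreal (4 * (1/16) ^ n)" for n
  proof (rule nn_integral_lim_le)
    show "AE x in M. (\<lambda>m. ennreal ((norm (q n x - q m x))\<^sup>2)) \<longlonglongrightarrow> ennreal ((norm (q n x - ?g x))\<^sup>2)"
      using conv by eventually_elim (intro tendsto_intros)
    show "\<forall>\<^sub>F m in sequentially. (\<integral>\<^sup>+x. ennreal ((norm (q n x - q m x))\<^sup>2) \<partial>M) \<le> ennreal (4 * (1/16) ^ n)"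
      using eventually_ge_at_top[of n] by eventually_elim (rule fast)
  qed measurable
qed

section \<open>Truncation and the Fourier energy of integrable functions\<close>

text \<open>Cutting off large arguments as well as large values makes the truncation bounded and, for a
  measurable function, integrable.\<close>

definition truncation :: "(real \<times> real \<Rightarrow> quat) \<Rightarrow> nat \<Rightarrow> real \<times> real \<Rightarrow> quat"
  where "truncation f n p = (if norm p \<le> real n \<and> norm (f p) \<le> real n then f p else 0)"

lemma norm_truncation_le: "norm (truncation f n p) \<le> norm (f p)" "norm (truncation f n p) \<le> real n"
  by (simp_all add: truncation_def)

lemma truncation_tendsto: "(\<lambda>n. truncation f n p) \<longlonglongrightarrow> f p"
proof (rule tendsto_eventually)
  obtain N where N: "max (norm p) (norm (f p)) \<le> real N"
    using real_arch_simple by blast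
  show "\<forall>\<^sub>F n in sequentially. truncation f n p = f p"
    using eventually_ge_at_top[of N]
    by eventually_elim (use N in \<open>auto simp: truncation_def\<close>)
qed

lemma measurable_truncation:
  assumes [measurable]: "f \<in> borel_measurable M" "(\<lambda>p. p) \<in> M \<rightarrow>\<^sub>M borel"
  shows "truncation f n \<in> borel_measurable M"
  unfolding truncation_def by measurable

text \<open>The truncations satisfy the Plancherel identity, and their transforms converge pointwise by
  dominated convergence, so Fatou's lemma applies.\<close>

lemma qft_energy_le:
  assumes F: "integrable lborel F"
  shows "(\<integral>\<^sup>+w. ennreal ((norm (qft F w))\<^sup>2) \<partial>lborel) \<le>
    ennreal (4 * pi\<^sup>2) * (\<integral>\<^sup>+p. ennreal ((norm (F p))\<^sup>2) \<partial>lborel)"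
proof (rule nn_integral_lim_le)
  have [measurable]: "F \<in> borel_measurable borel"
    using borel_measurable_integrable[OF F] by simp
  have T_meas [measurable]: "truncation F n \<in> borel_measurable borel" for n
    by (rule measurable_truncation) auto
  have T: "integrable lborel (truncation F n)" for n
    by (rule Bochner_Integration.integrable_bound[OF F]) (auto simp: norm_truncation_le)
  show "(\<lambda>w. ennreal ((norm (qft (truncation F n) w))\<^sup>2)) \<in> borel_measurable lborel" for n
    using measurable_qft[OF T_meas[of n]] by measurable
  show "AE w in lborel. (\<lambda>n. ennreal ((norm (qft (truncation F n) w))\<^sup>2)) \<longlonglongrightarrow> ennreal ((norm (qft F w))\<^sup>2)"
  proof (intro AE_I2 tendsto_ennrealI tendsto_power tendsto_norm)
    fix w
    have "(\<lambda>n. \<integral>p. qft_phase p w (truncation F n p) \<partial>lborel) \<longlonglongrightarrow> (\<integral>p. qft_phase p w (F p) \<partial>lborel)"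
    proof (rule integral_dominated_convergence[where w = "\<lambda>p. norm (F p)"])
      show "AE p in lborel. (\<lambda>n. qft_phase p w (truncation F n p)) \<longlonglongrightarrow> qft_phase p w (F p)"
        unfolding qft_phase_def by (intro AE_I2 tendsto_mult tendsto_const truncation_tendsto)
    qed (use F in \<open>auto simp: norm_truncation_le\<close>)
    then show "(\<lambda>n. qft (truncation F n) w) \<longlonglongrightarrow> qft F w"
      by (simp add: qft_def)
  qed
  show "\<forall>\<^sub>F n in sequentially. (\<integral>\<^sup>+w. ennreal ((norm (qft (truncation F n) w))\<^sup>2) \<partial>lborel) \<le>
      ennreal (4 * pi\<^sup>2) * (\<integral>\<^sup>+p. ennreal ((norm (F p))\<^sup>2) \<partial>lborel)"
    unfolding qft_plancherel_bounded[OF T norm_truncation_le(2)]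
    by (intro always_eventually allI mult_left_mono nn_integral_mono ennreal_leI power_mono norm_truncation_le) auto
qed

section \<open>The canonical transform as a rescaled Fourier transform\<close>

lemma nn_integral_lborel2_rescale:
  fixes G :: "real \<times> real \<Rightarrow> ennreal"
  assumes [measurable]: "G \<in> borel_measurable borel" and b: "b\<^sub>1 > 0" "b\<^sub>2 > 0"
  shows "(\<integral>\<^sup>+w. G (fst w / b\<^sub>1, snd w / b\<^sub>2) \<partial>lborel) = ennreal (b\<^sub>1 * b\<^sub>2) * (\<integral>\<^sup>+w. G w \<partial>lborel)"
proof -
  have G': "G \<in> borel_measurable (lborel \<Otimes>\<^sub>M lborel)"
    by (simp add: lborel_prod)
  have [measurable]: "G \<in> borel_measurable (borel \<Otimes>\<^sub>M borel)"
    by (simp add: borel_prod)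
  have "(\<integral>\<^sup>+w. G (fst w / b\<^sub>1, snd w / b\<^sub>2) \<partial>lborel) =
      (\<integral>\<^sup>+u. \<integral>\<^sup>+v. G (u / b\<^sub>1, v / b\<^sub>2) \<partial>lborel \<partial>lborel)"
    unfolding lborel_prod[symmetric] by (subst lborel.nn_integral_fst[symmetric]) simp_all
  also have "\<dots> = (\<integral>\<^sup>+u. ennreal b\<^sub>2 * (\<integral>\<^sup>+v. G (u / b\<^sub>1, v) \<partial>lborel) \<partial>lborel)"
  proof (rule nn_integral_cong)
    fix u
    show "(\<integral>\<^sup>+v. G (u / b\<^sub>1, v / b\<^sub>2) \<partial>lborel) = ennreal b\<^sub>2 * (\<integral>\<^sup>+v. G (u / b\<^sub>1, v) \<partial>lborel)"
      using b by (subst nn_integral_real_affine[of _ b\<^sub>2 0]) simp_all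
  qed
  also have "\<dots> = ennreal b\<^sub>2 * (\<integral>\<^sup>+u. \<integral>\<^sup>+v. G (u / b\<^sub>1, v) \<partial>lborel \<partial>lborel)"
    by (rule nn_integral_cmult) measurable
  also have "(\<integral>\<^sup>+u. \<integral>\<^sup>+v. G (u / b\<^sub>1, v) \<partial>lborel \<partial>lborel) =
      ennreal b\<^sub>1 * (\<integral>\<^sup>+u. \<integral>\<^sup>+v. G (u, v) \<partial>lborel \<partial>lborel)"
    using b by (subst nn_integral_real_affine[of _ b\<^sub>1 0]) simp_all
  also have "(\<integral>\<^sup>+u. \<integral>\<^sup>+v. G (u, v) \<partial>lborel \<partial>lborel) = (\<integral>\<^sup>+w. G w \<partial>lborel)"
    unfolding lborel.nn_integral_fst[OF G'] lborel_prod ..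
  finally show ?thesis
    using b by (simp add: ennreal_mult' mult_ac)
qed

text \<open>Fubini's theorem is applied on products of Borel measures, whereas the transform is defined for
  functions that are measurable with respect to the completion.\<close>

lemma lebesgue_measurable_Borel_representative:
  fixes f :: "'a::euclidean_space \<Rightarrow> 'b::euclidean_space"
  assumes [measurable]: "f \<in> borel_measurable lebesgue"
  obtains F where "F \<in> borel_measurable borel" "AE p in lborel. f p = F p"
proof -
  have "\<forall>b\<in>Basis. \<exists>h\<in>borel_measurable lborel. AE p in lborel. f p \<bullet> b = h p"
    by (intro ballI completion_ex_borel_measurable_real) measurable
  then obtain h where h: "\<And>b. b \<in> Basis \<Longrightarrow> h b \<in> borel_measurable lborel"
    "\<And>b. b \<in> Basis \<Longrightarrow> AE p in lborel. f p \<bullet> b = h b p"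
    by metis
  show thesis
  proof
    show "(\<lambda>p. \<Sum>b\<in>Basis. h b p *\<^sub>R b) \<in> borel_measurable borel"
      using h(1) by (intro borel_measurable_sum borel_measurable_scaleR) auto
    have "AE p in lborel. \<forall>b\<in>Basis. f p \<bullet> b = h b p"
      using h(2) by (intro AE_finite_allI) auto
    then show "AE p in lborel. f p = (\<Sum>b\<in>Basis. h b p *\<^sub>R b)"
    proof eventually_elim
      case (elim p)
      then have "(\<Sum>b\<in>Basis. h b p *\<^sub>R b) = (\<Sum>b\<in>Basis. (f p \<bullet> b) *\<^sub>R b)"
        by (intro sum.cong) auto
      then show ?case
        by (simp add: euclidean_representation)
    qed
  qed
qed

text \<open>The part of the kernels that depends on the time alone, absorbed into the function.\<close>

definition chirp :: "real^2^2 \<Rightarrow> real^2^2 \<Rightarrow> (real \<times> real \<Rightarrow> quat) \<Rightarrow> real \<times> real \<Rightarrow> quat"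
  where "chirp A\<^sub>1 A\<^sub>2 F p =
    quat_cis \<i>\<^sub>q (A\<^sub>1 $ 1 $ 1 / (2 * A\<^sub>1 $ 1 $ 2) * (fst p)\<^sup>2) * F p *
    quat_cis \<j>\<^sub>q (A\<^sub>2 $ 1 $ 1 / (2 * A\<^sub>2 $ 1 $ 2) * (snd p)\<^sup>2)"

lemma norm_chirp [simp]: "norm (chirp A\<^sub>1 A\<^sub>2 F p) = norm (F p)"
  by (simp add: chirp_def norm_mult)

lemma measurable_chirp [measurable]:
  assumes [measurable]: "F \<in> borel_measurable borel"
  shows "chirp A\<^sub>1 A\<^sub>2 F \<in> borel_measurable borel"
  unfolding chirp_def by measurable

text \<open>The phase is split into its frequency, mixed and time parts; the principal root
  \<open>sqrt \<mu> = exp (\<mu> * pi / 4)\<close> contributes the constant phase.\<close>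

lemma lct_kernel_factor:
  assumes \<mu>: "\<mu> * \<mu> = -1" and b: "A $ 1 $ 2 > 0"
  shows "lct_kernel \<mu> A x u = (1 / sqrt (2 * pi * A $ 1 $ 2)) *\<^sub>R
    quat_cis \<mu> ((A $ 2 $ 2 / (2 * A $ 1 $ 2) * u\<^sup>2 - pi / 4) + - (x * (u / A $ 1 $ 2))
      + A $ 1 $ 1 / (2 * A $ 1 $ 2) * x\<^sup>2)"
proof -
  let ?b = "A $ 1 $ 2"
  have "1 / quat_csqrt \<mu> (\<i> * of_real (2 * pi * ?b)) = inverse (sqrt (2 * pi * ?b) *\<^sub>R quat_cis \<mu> (pi / 4))"
    using b by (subst quat_csqrt_unit[OF \<mu>])
      (simp_all add: exp_scaleR_imaginary_unit[OF \<mu>] divide_quat_def)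
  also have "\<dots> = (1 / sqrt (2 * pi * ?b)) *\<^sub>R quat_cis \<mu> (- (pi / 4))"
    by (simp only: inverse_scaleR_distrib inverse_quat_cis[OF \<mu>]
          inverse_eq_divide[of "sqrt (2 * pi * ?b)"])
  finally have amplitude: "1 / quat_csqrt \<mu> (\<i> * of_real (2 * pi * ?b)) =
      (1 / sqrt (2 * pi * ?b)) *\<^sub>R quat_cis \<mu> (- (pi / 4))" .
  have angle: "- (pi / 4) + (A $ 1 $ 1 / (2 * ?b) * x\<^sup>2 - 1 / ?b * (x * u) + A $ 2 $ 2 / (2 * ?b) * u\<^sup>2) =
      (A $ 2 $ 2 / (2 * ?b) * u\<^sup>2 - pi / 4) + - (x * (u / ?b)) + A $ 1 $ 1 / (2 * ?b) * x\<^sup>2"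
    by simp
  show ?thesis
    unfolding lct_kernel_def amplitude exp_scaleR_imaginary_unit[OF \<mu>] mult_scaleR_left
      quat_cis_add[OF \<mu>, symmetric] angle ..
qed

text \<open>All exponentials on one side lie in a single commutative slice, so the time chirp can be moved next
  to the function and the frequency chirp to the outside.\<close>

lemma qlct_integrand:
  assumes b: "A\<^sub>1 $ 1 $ 2 > 0" "A\<^sub>2 $ 1 $ 2 > 0"
  shows "lct_kernel \<i>\<^sub>q A\<^sub>1 (fst p) u * F p * lct_kernel \<j>\<^sub>q A\<^sub>2 (snd p) v =
    (1 / (sqrt (2 * pi * A\<^sub>1 $ 1 $ 2) * sqrt (2 * pi * A\<^sub>2 $ 1 $ 2))) *\<^sub>R
    (quat_cis \<i>\<^sub>q (A\<^sub>1 $ 2 $ 2 / (2 * A\<^sub>1 $ 1 $ 2) * u\<^sup>2 - pi / 4) *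
     qft_phase p (u / A\<^sub>1 $ 1 $ 2, v / A\<^sub>2 $ 1 $ 2) (chirp A\<^sub>1 A\<^sub>2 F p) *
     quat_cis \<j>\<^sub>q (A\<^sub>2 $ 2 $ 2 / (2 * A\<^sub>2 $ 1 $ 2) * v\<^sup>2 - pi / 4))"
proof -
  note i = quat_units_mult(1) and j = quat_units_mult(2)
  have reorder: "quat_cis \<j>\<^sub>q (r + s + t) = quat_cis \<j>\<^sub>q t * quat_cis \<j>\<^sub>q s * quat_cis \<j>\<^sub>q r" for r s t
    by (simp add: quat_cis_add[OF j, symmetric] add_ac)
  show ?thesis
    unfolding lct_kernel_factor[OF i b(1)] lct_kernel_factor[OF j b(2)] quat_cis_add[OF i] reorder
      qft_phase_def chirp_def fst_conv snd_conv
    by (simp only: mult.assoc mult_scaleR_left mult_scaleR_right scaleR_scaleR) simp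
qed

lemma qlct_integral_eq_qft:
  assumes b: "A\<^sub>1 $ 1 $ 2 > 0" "A\<^sub>2 $ 1 $ 2 > 0" and F: "integrable lborel F"
  shows "qlct_integral A\<^sub>1 A\<^sub>2 F w =
    (1 / (sqrt (2 * pi * A\<^sub>1 $ 1 $ 2) * sqrt (2 * pi * A\<^sub>2 $ 1 $ 2))) *\<^sub>R
    (quat_cis \<i>\<^sub>q (A\<^sub>1 $ 2 $ 2 / (2 * A\<^sub>1 $ 1 $ 2) * (fst w)\<^sup>2 - pi / 4) *
     qft (chirp A\<^sub>1 A\<^sub>2 F) (fst w / A\<^sub>1 $ 1 $ 2, snd w / A\<^sub>2 $ 1 $ 2) *
     quat_cis \<j>\<^sub>q (A\<^sub>2 $ 2 $ 2 / (2 * A\<^sub>2 $ 1 $ 2) * (snd w)\<^sup>2 - pi / 4))"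
proof -
  obtain u v where w: "w = (u, v)" by (cases w)
  have F_meas [measurable]: "F \<in> borel_measurable borel"
    using borel_measurable_integrable[OF F] by simp
  have C: "integrable lborel (chirp A\<^sub>1 A\<^sub>2 F)"
    by (rule Bochner_Integration.integrable_bound[OF F]) auto
  note P = integrable_qft_phase[OF C]
  have "qlct_integral A\<^sub>1 A\<^sub>2 F w =
    (\<integral>p. lct_kernel \<i>\<^sub>q A\<^sub>1 (fst p) u * F p * lct_kernel \<j>\<^sub>q A\<^sub>2 (snd p) v \<partial>lebesgue)"
    by (simp add: qlct_integral_def w case_prod_unfold)
  also have "\<dots> = (\<integral>p. lct_kernel \<i>\<^sub>q A\<^sub>1 (fst p) u * F p * lct_kernel \<j>\<^sub>q A\<^sub>2 (snd p) v \<partial>lborel)"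
    unfolding qlct_integrand[OF b] by (rule integral_completion) measurable
  finally show ?thesis
    unfolding qlct_integrand[OF b] using P by (simp add: w qft_def)
qed

text \<open>The squared amplitude \<open>1 / (4 * pi\<^sup>2 * b\<^sub>1 * b\<^sub>2)\<close> times the Jacobian \<open>b\<^sub>1 * b\<^sub>2\<close> of the
  rescaling is the normalising constant of the QFT.\<close>

lemma borel_qlct_integral:
  assumes b: "A\<^sub>1 $ 1 $ 2 > 0" "A\<^sub>2 $ 1 $ 2 > 0" and F: "integrable lborel F"
  shows "qlct_integral A\<^sub>1 A\<^sub>2 F \<in> borel_measurable borel"
    and "L2_norm_sq (qlct_integral A\<^sub>1 A\<^sub>2 F) =
      ennreal (1 / (4 * pi\<^sup>2)) * (\<integral>\<^sup>+w. ennreal ((norm (qft (chirp A\<^sub>1 A\<^sub>2 F) w))\<^sup>2) \<partial>lborel)"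
proof -
  have F_meas [measurable]: "F \<in> borel_measurable borel"
    using borel_measurable_integrable[OF F] by simp
  note [measurable] = measurable_qft[OF measurable_chirp[OF F_meas]]
  have pair [measurable]: "(\<lambda>w. (fst w / A\<^sub>1 $ 1 $ 2, snd w / A\<^sub>2 $ 1 $ 2)) \<in> borel \<rightarrow>\<^sub>M borel"
    by (intro borel_measurable_continuous_onI continuous_intros) (use b in auto)
  show "qlct_integral A\<^sub>1 A\<^sub>2 F \<in> borel_measurable borel"
    unfolding qlct_integral_eq_qft[OF b F, abs_def] by measurable
  let ?b = "A\<^sub>1 $ 1 $ 2 * A\<^sub>2 $ 1 $ 2"
  let ?E = "\<lambda>w. ennreal ((norm (qft (chirp A\<^sub>1 A\<^sub>2 F) w))\<^sup>2)"
  have "L2_norm_sq (qlct_integral A\<^sub>1 A\<^sub>2 F) =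
    (\<integral>\<^sup>+w. ennreal (1 / (4 * pi\<^sup>2 * ?b)) * ?E (fst w / A\<^sub>1 $ 1 $ 2, snd w / A\<^sub>2 $ 1 $ 2) \<partial>lborel)"
    unfolding L2_norm_sq_def nn_integral_completion
  proof (rule nn_integral_cong)
    fix w
    have eq: "(norm (qlct_integral A\<^sub>1 A\<^sub>2 F w))\<^sup>2 = 1 / (4 * pi\<^sup>2 * ?b) *
      (norm (qft (chirp A\<^sub>1 A\<^sub>2 F) (fst w / A\<^sub>1 $ 1 $ 2, snd w / A\<^sub>2 $ 1 $ 2)))\<^sup>2"
      unfolding qlct_integral_eq_qft[OF b F] using b
      by (simp add: norm_mult power_mult_distrib power_divide abs_mult) (simp add: power2_eq_square)
    show "ennreal ((norm (qlct_integral A\<^sub>1 A\<^sub>2 F w))\<^sup>2) =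
      ennreal (1 / (4 * pi\<^sup>2 * ?b)) * ?E (fst w / A\<^sub>1 $ 1 $ 2, snd w / A\<^sub>2 $ 1 $ 2)"
      unfolding eq by (rule ennreal_mult) (use b in auto)
  qed
  also have "\<dots> = ennreal (1 / (4 * pi\<^sup>2 * ?b)) * (ennreal ?b * (\<integral>\<^sup>+w. ?E w \<partial>lborel))"
    using nn_integral_lborel2_rescale[of ?E, OF _ b] by (subst nn_integral_cmult) simp_all
  also have "\<dots> = ennreal (1 / (4 * pi\<^sup>2)) * (\<integral>\<^sup>+w. ?E w \<partial>lborel)"
    using b by (subst mult.assoc[symmetric], subst ennreal_mult'[symmetric]) (simp_all add: field_simps)
  finally show "L2_norm_sq (qlct_integral A\<^sub>1 A\<^sub>2 F) = \<dots>" .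
qed

lemma quat_L1_Borel_representative:
  assumes f: "f \<in> quat_L1"
  obtains F where "integrable lborel F" "AE p in lborel. f p = F p"
    and "\<And>A\<^sub>1 A\<^sub>2. A\<^sub>1 $ 1 $ 2 > 0 \<Longrightarrow> A\<^sub>2 $ 1 $ 2 > 0 \<Longrightarrow> qlct_integral A\<^sub>1 A\<^sub>2 f = qlct_integral A\<^sub>1 A\<^sub>2 F"
    and "L2_norm_sq f = (\<integral>\<^sup>+p. ennreal ((norm (F p))\<^sup>2) \<partial>lborel)"
proof -
  have int: "integrable lebesgue f" and [measurable]: "f \<in> borel_measurable lebesgue"
    using f by (auto simp: quat_L1_def)
  obtain F where F[measurable]: "F \<in> borel_measurable borel" and ae: "AE p in lborel. f p = F p"
    using lebesgue_measurable_Borel_representative[of f] by auto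
  have ae': "AE p in lebesgue. f p = F p"
    by (rule AE_completion[OF ae])
  have F': "F \<in> borel_measurable lebesgue"
    by (rule measurable_completion) simp
  have "integrable lebesgue F"
    by (subst integrable_cong_AE[of _ _ f]) (use ae' F' int in auto)
  then have "integrable lborel F"
    by (subst (asm) integrable_completion) auto
  moreover have "qlct_integral A\<^sub>1 A\<^sub>2 f = qlct_integral A\<^sub>1 A\<^sub>2 F"
    if b: "A\<^sub>1 $ 1 $ 2 > 0" "A\<^sub>2 $ 1 $ 2 > 0" for A\<^sub>1 A\<^sub>2
  proof -
    have K: "(\<lambda>p. lct_kernel \<i>\<^sub>q A\<^sub>1 (fst p) u) \<in> borel_measurable lebesgue"
      "(\<lambda>p. lct_kernel \<j>\<^sub>q A\<^sub>2 (snd p) v) \<in> borel_measurable lebesgue" for u v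
      unfolding lct_kernel_factor[OF quat_units_mult(1) b(1)] lct_kernel_factor[OF quat_units_mult(2) b(2)]
      by (rule measurable_completion; measurable)+
    note [measurable] = K F'
    show ?thesis
      unfolding qlct_integral_def case_prod_unfold prod.collapse
      by (intro ext integral_cong_AE) (use ae' in \<open>measurable, auto elim!: eventually_mono\<close>)
  qed
  moreover have "L2_norm_sq f = (\<integral>\<^sup>+p. ennreal ((norm (F p))\<^sup>2) \<partial>lborel)"
    unfolding L2_norm_sq_def nn_integral_completion
    by (rule nn_integral_cong_AE) (use ae in \<open>auto elim!: eventually_mono\<close>)
  ultimately show thesis
    using that ae by blast
qed

lemma ennreal_pi_cancel: "ennreal (1 / (4 * pi\<^sup>2)) * (ennreal (4 * pi\<^sup>2) * x) = x"
  by (simp add: mult.assoc[symmetric] ennreal_mult'[symmetric])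

lemma measurable_qlct_integral:
  assumes b: "A\<^sub>1 $ 1 $ 2 > 0" "A\<^sub>2 $ 1 $ 2 > 0" and f: "f \<in> quat_L1"
  shows "qlct_integral A\<^sub>1 A\<^sub>2 f \<in> borel_measurable lebesgue"
proof -
  obtain F where F: "integrable lborel F" "qlct_integral A\<^sub>1 A\<^sub>2 f = qlct_integral A\<^sub>1 A\<^sub>2 F"
    using quat_L1_Borel_representative[OF f] b by metis
  then show ?thesis
    using borel_qlct_integral(1)[OF b F(1)] by (simp add: measurable_completion)
qed

lemma qlct_integral_L2_le:
  assumes b: "A\<^sub>1 $ 1 $ 2 > 0" "A\<^sub>2 $ 1 $ 2 > 0" and f: "f \<in> quat_L1"
  shows "L2_norm_sq (qlct_integral A\<^sub>1 A\<^sub>2 f) \<le> L2_norm_sq f"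
proof -
  obtain F where F: "integrable lborel F" and
    eq: "qlct_integral A\<^sub>1 A\<^sub>2 f = qlct_integral A\<^sub>1 A\<^sub>2 F"
      "L2_norm_sq f = (\<integral>\<^sup>+p. ennreal ((norm (F p))\<^sup>2) \<partial>lborel)"
    using quat_L1_Borel_representative[OF f] b by metis
  have [measurable]: "F \<in> borel_measurable borel"
    using borel_measurable_integrable[OF F] by simp
  have C: "integrable lborel (chirp A\<^sub>1 A\<^sub>2 F)"
    by (rule Bochner_Integration.integrable_bound[OF F]) auto
  have "L2_norm_sq (qlct_integral A\<^sub>1 A\<^sub>2 f) \<le>
      ennreal (1 / (4 * pi\<^sup>2)) * (ennreal (4 * pi\<^sup>2) * (\<integral>\<^sup>+p. ennreal ((norm (chirp A\<^sub>1 A\<^sub>2 F p))\<^sup>2) \<partial>lborel))"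
    unfolding eq borel_qlct_integral(2)[OF b F] by (intro mult_left_mono qft_energy_le C) simp
  then show ?thesis
    by (simp only: ennreal_pi_cancel norm_chirp eq)
qed

text \<open>A Borel representative of a bounded function may be unbounded on a null set; it is set to zero
  there.\<close>

lemma qlct_plancherel_bounded:
  assumes b: "A\<^sub>1 $ 1 $ 2 > 0" "A\<^sub>2 $ 1 $ 2 > 0" and f: "f \<in> quat_L1"
    and M: "\<And>p. norm (f p) \<le> M"
  shows "L2_norm_sq (qlct_integral A\<^sub>1 A\<^sub>2 f) = L2_norm_sq f"
proof -
  obtain F where F: "integrable lborel F" and ae: "AE p in lborel. f p = F p" and
    eq: "qlct_integral A\<^sub>1 A\<^sub>2 f = qlct_integral A\<^sub>1 A\<^sub>2 F"
      "L2_norm_sq f = (\<integral>\<^sup>+p. ennreal ((norm (F p))\<^sup>2) \<partial>lborel)"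
    using quat_L1_Borel_representative[OF f] b by metis
  have [measurable]: "F \<in> borel_measurable borel"
    using borel_measurable_integrable[OF F] by simp
  define G where "G p = (if norm (F p) \<le> M then F p else 0)" for p
  have [measurable]: "G \<in> borel_measurable borel"
    unfolding G_def by measurable
  have C: "integrable lborel (chirp A\<^sub>1 A\<^sub>2 G)"
    by (rule Bochner_Integration.integrable_bound[OF F]) (auto simp: G_def)
  have bound: "norm (chirp A\<^sub>1 A\<^sub>2 G p) \<le> M" for p
    using order_trans[OF norm_ge_zero M[of p]] by (simp add: G_def)
  have FG: "AE p in lborel. F p = G p"
    using ae
  proof eventually_elim
    case (elim p)
    then show ?case using M[of p] by (simp add: G_def)
  qed
  have "qft (chirp A\<^sub>1 A\<^sub>2 F) = qft (chirp A\<^sub>1 A\<^sub>2 G)"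
    unfolding qft_def by (intro ext integral_cong_AE) (use FG in \<open>auto elim!: eventually_mono simp: chirp_def\<close>)
  moreover have "(\<integral>\<^sup>+p. ennreal ((norm (F p))\<^sup>2) \<partial>lborel) = (\<integral>\<^sup>+p. ennreal ((norm (G p))\<^sup>2) \<partial>lborel)"
    by (rule nn_integral_cong_AE) (use FG in \<open>auto elim!: eventually_mono\<close>)
  ultimately show ?thesis
    unfolding eq borel_qlct_integral(2)[OF b F]
    by (simp only: qft_plancherel_bounded[OF C bound] ennreal_pi_cancel norm_chirp)
qed

lemma qlct_integral_diff:
  assumes b: "A\<^sub>1 $ 1 $ 2 > 0" "A\<^sub>2 $ 1 $ 2 > 0" and f: "f \<in> quat_L1" and g: "g \<in> quat_L1"
  shows "qlct_integral A\<^sub>1 A\<^sub>2 (\<lambda>p. f p - g p) w = qlct_integral A\<^sub>1 A\<^sub>2 f w - qlct_integral A\<^sub>1 A\<^sub>2 g w"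
proof -
  have int: "integrable lebesgue (\<lambda>p. lct_kernel \<i>\<^sub>q A\<^sub>1 (fst p) u * h p * lct_kernel \<j>\<^sub>q A\<^sub>2 (snd p) v)"
    if h: "h \<in> quat_L1" for h u v
  proof (rule Bochner_Integration.integrable_bound)
    let ?k = "1 / (sqrt (2 * pi * A\<^sub>1 $ 1 $ 2) * sqrt (2 * pi * A\<^sub>2 $ 1 $ 2))"
    show "integrable lebesgue (\<lambda>p. ?k *\<^sub>R h p)"
      using h by (auto simp: quat_L1_def)
    have [measurable]: "h \<in> borel_measurable lebesgue"
      using h by (auto simp: quat_L1_def)
    have [measurable]: "(\<lambda>p. lct_kernel \<i>\<^sub>q A\<^sub>1 (fst p) u) \<in> borel_measurable lebesgue"
      "(\<lambda>p. lct_kernel \<j>\<^sub>q A\<^sub>2 (snd p) v) \<in> borel_measurable lebesgue"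
      unfolding lct_kernel_factor[OF quat_units_mult(1) b(1)] lct_kernel_factor[OF quat_units_mult(2) b(2)]
      by (rule measurable_completion; measurable)+
    show "(\<lambda>p. lct_kernel \<i>\<^sub>q A\<^sub>1 (fst p) u * h p * lct_kernel \<j>\<^sub>q A\<^sub>2 (snd p) v) \<in> borel_measurable lebesgue"
      by measurable
  qed (auto simp: qlct_integrand[OF b] norm_mult)
  show ?thesis
    using Bochner_Integration.integral_diff[OF int[OF f] int[OF g], of "fst w" "snd w" "fst w" "snd w"]
    by (simp add: qlct_integral_def case_prod_unfold algebra_simps)
qed

section \<open>Extension to square integrable functions\<close>

lemma truncation_in_L1_L2:
  assumes f: "f \<in> quat_L2"
  shows "truncation f n \<in> quat_L1 \<inter> quat_L2"
proof -
  have f_meas: "f \<in> borel_measurable lebesgue" and fin: "L2_norm_sq f < \<infinity>"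
    using f by (auto simp: quat_L2_def)
  have T [measurable]: "truncation f n \<in> borel_measurable lebesgue"
    by (rule measurable_truncation[OF f_meas]) (simp add: measurable_completion)
  have "integrable lebesgue (\<lambda>p. real n * indicator (cball (0 :: real \<times> real) (real n)) p)"
    by (intro integrable_mult_right integrable_real_indicator) (use emeasure_bounded_finite[OF bounded_cball] in auto)
  then have "integrable lebesgue (truncation f n)"
    by (rule Bochner_Integration.integrable_bound)
       (auto simp: truncation_def split: split_indicator)
  moreover have "L2_norm_sq (truncation f n) \<le> L2_norm_sq f"
    unfolding L2_norm_sq_def
    by (intro nn_integral_mono ennreal_leI power_mono norm_truncation_le) auto
  ultimately show ?thesis
    using fin by (auto simp: quat_L1_def quat_L2_def)
qed

lemma truncation_tendsto_L2:
  assumes f: "f \<in> quat_L2"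
  shows "(\<lambda>n. L2_norm_sq (\<lambda>p. truncation f n p - f p)) \<longlonglongrightarrow> 0"
proof -
  have f_meas [measurable]: "f \<in> borel_measurable lebesgue" and fin: "L2_norm_sq f < \<infinity>"
    using f by (auto simp: quat_L2_def)
  have [measurable]: "truncation f n \<in> borel_measurable lebesgue" for n
    by (rule measurable_truncation[OF f_meas]) (simp add: measurable_completion)
  have "(\<lambda>n. \<integral>\<^sup>+p. ennreal ((norm (truncation f n p - f p))\<^sup>2) \<partial>lebesgue) \<longlonglongrightarrow>
      (\<integral>\<^sup>+p. 0 \<partial>(lebesgue :: (real \<times> real) measure))"
  proof (rule nn_integral_dominated_convergence[where w = "\<lambda>p. ennreal ((norm (f p))\<^sup>2)"])
    show "AE p in lebesgue. ennreal ((norm (truncation f n p - f p))\<^sup>2) \<le> ennreal ((norm (f p))\<^sup>2)" for n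
      by (auto simp: truncation_def)
    show "AE p in lebesgue. (\<lambda>n. ennreal ((norm (truncation f n p - f p))\<^sup>2)) \<longlonglongrightarrow> 0"
    proof (rule AE_I2)
      fix p
      have "(\<lambda>n. ennreal ((norm (truncation f n p - f p))\<^sup>2)) \<longlonglongrightarrow> ennreal ((norm (f p - f p))\<^sup>2)"
        by (intro tendsto_intros truncation_tendsto)
      then show "(\<lambda>n. ennreal ((norm (truncation f n p - f p))\<^sup>2)) \<longlonglongrightarrow> 0"
        by simp
    qed
  qed (use fin in \<open>auto simp: L2_norm_sq_def\<close>)
  then show ?thesis
    by (simp add: L2_norm_sq_def)
qed

text \<open>The transform is linear and contracting, so transforms of two approximants are as close as the
  approximants, which are compared through \<open>f\<close>.\<close>

lemma qlct_integral_L2_dist_le: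
  assumes b: "A\<^sub>1 $ 1 $ 2 > 0" "A\<^sub>2 $ 1 $ 2 > 0"
    and h: "h \<in> quat_L1 \<inter> quat_L2" and k: "k \<in> quat_L1 \<inter> quat_L2" and f: "f \<in> quat_L2"
  shows "L2_norm_sq (\<lambda>w. qlct_integral A\<^sub>1 A\<^sub>2 h w - qlct_integral A\<^sub>1 A\<^sub>2 k w) \<le>
    2 * L2_norm_sq (\<lambda>p. h p - f p) + 2 * L2_norm_sq (\<lambda>p. k p - f p)"
proof -
  have "(\<lambda>p. h p - k p) \<in> quat_L1"
    using h k by (auto simp: quat_L1_def)
  then have "L2_norm_sq (qlct_integral A\<^sub>1 A\<^sub>2 (\<lambda>p. h p - k p)) \<le> L2_norm_sq (\<lambda>p. h p - k p)"
    by (rule qlct_integral_L2_le[OF b])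
  also have "\<dots> \<le> 2 * L2_norm_sq (\<lambda>p. h p - f p) + 2 * L2_norm_sq (\<lambda>p. k p - f p)"
    using L2_norm_sq_diff_le[of h f k] h k f L2_norm_sq_minus_commute[of f k]
    by (auto simp: quat_L2_def)
  also have "qlct_integral A\<^sub>1 A\<^sub>2 (\<lambda>p. h p - k p) =
      (\<lambda>w. qlct_integral A\<^sub>1 A\<^sub>2 h w - qlct_integral A\<^sub>1 A\<^sub>2 k w)"
    using h k by (intro ext qlct_integral_diff[OF b]) auto
  finally show ?thesis .
qed

text \<open>A subsequence of the truncations converges to \<open>f\<close> fast enough for its transforms to have an
  \<open>L\<^sup>2\<close> limit.  Any other approximating sequence has transforms asymptotically close to these, by
  the contraction estimate, and so the same limit.\<close>

lemma has_qlct_exists: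
  assumes b: "A\<^sub>1 $ 1 $ 2 > 0" "A\<^sub>2 $ 1 $ 2 > 0" and f: "f \<in> quat_L2"
  shows "\<exists>g. has_qlct A\<^sub>1 A\<^sub>2 f g"
proof -
  have "\<exists>m. L2_norm_sq (\<lambda>p. truncation f m p - f p) \<le> ennreal ((1/16) ^ n)" for n
  proof -
    have "\<forall>\<^sub>F m in sequentially. L2_norm_sq (\<lambda>p. truncation f m p - f p) < ennreal ((1/16) ^ n)"
      by (rule order_tendstoD(2)[OF truncation_tendsto_L2[OF f]]) simp
    then show ?thesis
      by (auto simp: eventually_sequentially intro: less_imp_le)
  qed
  then obtain r where r: "\<And>n. L2_norm_sq (\<lambda>p. truncation f (r n) p - f p) \<le> ennreal ((1/16) ^ n)"
    by metis
  define h where "h n = truncation f (r n)" for n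
  let ?Q = "qlct_integral A\<^sub>1 A\<^sub>2"
  have h: "h n \<in> quat_L1 \<inter> quat_L2" for n
    unfolding h_def by (rule truncation_in_L1_L2[OF f])
  have hf: "L2_norm_sq (\<lambda>p. h n p - f p) \<le> ennreal ((1/16) ^ n)" for n
    unfolding h_def by (rule r)
  have Q_meas [measurable]: "?Q k \<in> borel_measurable lebesgue" if "k \<in> quat_L1 \<inter> quat_L2" for k
    using that measurable_qlct_integral[OF b] by blast
  have Qh_meas: "?Q (h n) \<in> borel_measurable lebesgue" for n
    by (rule Q_meas[OF h])
  have fast: "(\<integral>\<^sup>+w. ennreal ((norm (?Q (h n) w - ?Q (h m) w))\<^sup>2) \<partial>lebesgue) \<le> ennreal (4 * (1/16) ^ n)"
    if "n \<le> m" for n m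
  proof -
    have "L2_norm_sq (\<lambda>w. ?Q (h n) w - ?Q (h m) w) \<le>
        2 * ennreal ((1/16) ^ n) + 2 * ennreal ((1/16) ^ m)"
      by (rule order_trans[OF qlct_integral_L2_dist_le[OF b h h f]])
         (intro add_mono mult_left_mono hf; simp)
    also have "\<dots> \<le> 2 * ennreal ((1/16) ^ n) + 2 * ennreal ((1/16) ^ n)"
      using that by (intro add_mono mult_left_mono ennreal_leI power_decreasing) auto
    also have "\<dots> = ennreal (4 * (1/16) ^ n)"
      by (simp add: ennreal_mult' flip: distrib_right)
    finally show ?thesis
      by (simp add: L2_norm_sq_def)
  qed
  obtain g where g_meas: "g \<in> borel_measurable lebesgue"
    and "\<And>n. (\<integral>\<^sup>+w. ennreal ((norm (?Q (h n) w - g w))\<^sup>2) \<partial>lebesgue) \<le> ennreal (4 * (1/16) ^ n)"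
    using fast_L2_Cauchy_limit[of "\<lambda>n. ?Q (h n)" lebesgue, OF Qh_meas fast] by blast
  then have g: "L2_norm_sq (\<lambda>w. ?Q (h n) w - g w) \<le> ennreal (4 * (1/16) ^ n)" for n
    by (simp add: L2_norm_sq_def)
  have "(\<lambda>n. ennreal (4 * (1/16) ^ n)) \<longlonglongrightarrow> ennreal (4 * 0)"
    by (intro tendsto_ennrealI tendsto_mult tendsto_const LIMSEQ_power_zero) simp
  then have geom: "(\<lambda>n. ennreal (4 * (1/16) ^ n)) \<longlonglongrightarrow> 0"
    by simp
  have Qh_L2: "?Q (h n) \<in> quat_L2" for n
    using qlct_integral_L2_le[OF b, of "h n"] h[of n] Qh_meas[of n]
    by (auto simp: quat_L2_def intro: le_less_trans)
  have "has_qlct A\<^sub>1 A\<^sub>2 f g"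
    unfolding has_qlct_def
  proof (intro conjI allI impI)
    have "(\<lambda>w. ?Q (h 0) w - g w) \<in> quat_L2"
      using g[of 0] Qh_meas[of 0] g_meas
      by (auto simp: quat_L2_def intro: le_less_trans)
    from quat_L2_diff[OF Qh_L2[of 0] this] show "g \<in> quat_L2"
      by simp
    fix k assume k: "\<forall>n. k n \<in> quat_L1 \<inter> quat_L2"
      and kf: "(\<lambda>n. L2_norm_sq (\<lambda>p. k n p - f p)) \<longlonglongrightarrow> 0"
    have bound: "L2_norm_sq (\<lambda>w. ?Q (k n) w - g w) \<le>
        2 * (2 * L2_norm_sq (\<lambda>p. k n p - f p) + 2 * ennreal (4 * (1/16) ^ n)) + 2 * ennreal (4 * (1/16) ^ n)" for n
    proof -
      have kn: "k n \<in> quat_L1 \<inter> quat_L2"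
        using k by blast
      have hf': "L2_norm_sq (\<lambda>p. h n p - f p) \<le> ennreal (4 * (1/16) ^ n)"
        by (rule order_trans[OF hf]) (intro ennreal_leI, simp)
      have "L2_norm_sq (\<lambda>w. ?Q (k n) w - g w) \<le>
        2 * L2_norm_sq (\<lambda>w. ?Q (k n) w - ?Q (h n) w) + 2 * L2_norm_sq (\<lambda>w. ?Q (h n) w - g w)"
        by (rule L2_norm_sq_diff_le[OF Q_meas[OF kn] Qh_meas g_meas])
      also have "\<dots> \<le> 2 * (2 * L2_norm_sq (\<lambda>p. k n p - f p) + 2 * L2_norm_sq (\<lambda>p. h n p - f p))
          + 2 * ennreal (4 * (1/16) ^ n)"
        by (intro add_mono mult_left_mono qlct_integral_L2_dist_le[OF b kn h f] g) simp_all
      also have "\<dots> \<le> 2 * (2 * L2_norm_sq (\<lambda>p. k n p - f p) + 2 * ennreal (4 * (1/16) ^ n))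
          + 2 * ennreal (4 * (1/16) ^ n)"
        by (intro add_mono mult_left_mono hf' order_refl) simp_all
      finally show ?thesis .
    qed
    have "(\<lambda>n. 2 * (2 * L2_norm_sq (\<lambda>p. k n p - f p) + 2 * ennreal (4 * (1/16) ^ n)) + 2 * ennreal (4 * (1/16) ^ n))
        \<longlonglongrightarrow> 2 * (2 * 0 + 2 * 0) + 2 * 0"
      by (intro tendsto_add ennreal_tendsto_cmult kf geom) simp_all
    then have "(\<lambda>n. 2 * (2 * L2_norm_sq (\<lambda>p. k n p - f p) + 2 * ennreal (4 * (1/16) ^ n)) + 2 * ennreal (4 * (1/16) ^ n))
        \<longlonglongrightarrow> 0"
      by simp
    then show "(\<lambda>n. L2_norm_sq (\<lambda>w. ?Q (k n) w - g w)) \<longlonglongrightarrow> 0"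
      by (rule tendsto_sandwich[OF always_eventually always_eventually tendsto_const, rotated 2])
         (use bound in auto)
  qed
  then show ?thesis by blast
qed

theorem theorem3p1:
  fixes A\<^sub>1 A\<^sub>2 :: "real^2^2" and f :: "real \<times> real \<Rightarrow> quat"
  assumes "det A\<^sub>1 = 1" and "det A\<^sub>2 = 1"
    and "A\<^sub>1 $ 1 $ 2 > 0" and "A\<^sub>2 $ 1 $ 2 > 0"
    and "f \<in> quat_L2"
  shows "L2_norm_sq f = L2_norm_sq (qlct A\<^sub>1 A\<^sub>2 f)"
proof -
  note b = assms(3,4) and f = assms(5)
  let ?g = "qlct A\<^sub>1 A\<^sub>2 f" and ?Q = "qlct_integral A\<^sub>1 A\<^sub>2"
  have "has_qlct A\<^sub>1 A\<^sub>2 f ?g"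
    unfolding qlct_def by (rule someI_ex[OF has_qlct_exists[OF b f]])
  then have g: "?g \<in> quat_L2" and
    lim: "(\<lambda>n. L2_norm_sq (\<lambda>w. ?Q (truncation f n) w - ?g w)) \<longlonglongrightarrow> 0"
    unfolding has_qlct_def using truncation_in_L1_L2[OF f] truncation_tendsto_L2[OF f] by blast+
  have eq: "L2_norm_sq (?Q (truncation f n)) = L2_norm_sq (truncation f n)" for n
    using truncation_in_L1_L2[OF f] by (intro qlct_plancherel_bounded[OF b _ norm_truncation_le(2)]) blast
  have T: "truncation f n \<in> quat_L2" for n
    using truncation_in_L1_L2[OF f] by blast
  have Q: "?Q (truncation f n) \<in> quat_L2" for n
    using T[of n] eq[of n] measurable_qlct_integral[OF b, of "truncation f n"] truncation_in_L1_L2[OF f, of n]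
    by (simp add: quat_L2_def)
  have "(\<lambda>n. L2_norm_sq (truncation f n)) \<longlonglongrightarrow> L2_norm_sq f"
    by (rule L2_norm_sq_tendsto[OF T f truncation_tendsto_L2[OF f]])
  moreover have "(\<lambda>n. L2_norm_sq (truncation f n)) \<longlonglongrightarrow> L2_norm_sq ?g"
    using L2_norm_sq_tendsto[OF Q g lim] by (simp only: eq)
  ultimately show ?thesis
    by (rule LIMSEQ_unique)
qed

end
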